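(* Let $k\ge3$ be an integer. Let $S\subset\mathbb{P}^N$ be a surface scroll embedded by $|V|$, where $V\subseteq H^0(S,L)$, $L=\mathcal{O}_{\mathbb{P}^N}(1)|_S$, and suppose that $N\ge 2k$. Let $x\in S$ and denote by $f_x$ the fibre of $S$ through $x$. If $|V-tf_x|$ is very ample for every non-negative integer $t\le k-2$, then $$\dim\mathrm{Osc}^k_x(S)\ge k+2.$$
   Context: We work over $\mathbb{C}$. A surface scroll is an embedded smooth projective surface $S\subset\mathbb{P}^N$ endowed with a morphism $\pi:S\to C$ onto a smooth curve such that every fibre $f$ satisfies $(f,\mathcal{O}_{\mathbb{P}^N}(1)|_f)=(\mathbb{P}^1,\mathcal{O}_{\mathbb{P}^1}(1))$. Here $\mathbb{P}^N=\mathbb{P}(V)$ (the set of codimension-one subspaces of $V$), so $S$ is non-degenerate and $|V|$, the (not necessarily complete) linear system of hyperplane sections, has dimension $N$. $|V-tf_x|$ denotes the linear system, contained in $|L-tf_x|$, defined by the subspace of sections of $V$ vanishing on the divisor $tf_x$, viewed as a subspace of $H^0(S,L\otimes\mathcal{O}_S(-tf_x))$. A linear system is very ample if the map it defines is an embedding. For $x\in S$ let $j_{k,x}:V\to(J_kL)_x$ be the map sending a section to its $k$-th jet at $x$ ($J_kL$ the $k$-th jet bundle). The $k$-th osculating space $\mathrm{Osc}^k_x(S)=\mathbb{P}(\mathrm{Im}\,j_{k,x})$ is a linear subspace of $\mathbb{P}^N=\mathbb{P}(V)$ of dimension $\mathrm{rk}(j_{k,x})-1$. *)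

theory Defs
  imports "HOL-Analysis.Analysis"
begin

text \<open>
  Projective varieties over the complex numbers in the classical language.  A point of
  \<open>P\<^sup>N\<close>, where \<open>N + 1 = CARD('n)\<close>, is a nonzero vector of \<^typ>\<open>complex^'n\<close> up to scaling, and a subset
  of \<open>P\<^sup>N\<close> is represented by its punctured affine cone.  Sections of \<open>O(m)\<close> are homogeneous
  functions of degree \<open>m\<close> on cones.
\<close>

definition proj_eq :: "complex^'n \<Rightarrow> complex^'n \<Rightarrow> bool" where
  "proj_eq x y \<longleftrightarrow> (\<exists>c. c \<noteq> 0 \<and> x = c *s y)"

text \<open>Homogeneous polynomials, as functions; the zero polynomial has every degree.\<close>

inductive homogeneous_poly :: "nat \<Rightarrow> (complex^'n \<Rightarrow> complex) \<Rightarrow> bool" where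
  const: "homogeneous_poly 0 (\<lambda>x. c)"
| coord: "homogeneous_poly 1 (\<lambda>x. x $ i)"
| add: "homogeneous_poly d p \<Longrightarrow> homogeneous_poly d q \<Longrightarrow> homogeneous_poly d (\<lambda>x. p x + q x)"
| mult: "homogeneous_poly d p \<Longrightarrow> homogeneous_poly e q \<Longrightarrow>
    homogeneous_poly (d + e) (\<lambda>x. p x * q x)"

definition linear_form :: "complex^'n \<Rightarrow> complex^'n \<Rightarrow> complex" where
  "linear_form a x = (\<Sum>i\<in>UNIV. a $ i * x $ i)"

definition projective_closed :: "(complex^'n) set \<Rightarrow> bool" where
  "projective_closed X \<longleftrightarrow>
     (\<exists>\<F>. (\<forall>F\<in>\<F>. \<exists>d. homogeneous_poly d F) \<and> X = {x. x \<noteq> 0 \<and> (\<forall>F\<in>\<F>. F x = 0)})"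

definition projective_variety :: "(complex^'n) set \<Rightarrow> bool" where
  "projective_variety X \<longleftrightarrow> projective_closed X \<and> X \<noteq> {} \<and>
     (\<forall>A B. projective_closed A \<and> projective_closed B \<and> X \<subseteq> A \<union> B \<longrightarrow> X \<subseteq> A \<or> X \<subseteq> B)"

text \<open>The property \<open>P\<close> holds on a Zariski open neighbourhood of \<open>p\<close> in \<open>X\<close>.\<close>

definition zariski_near :: "(complex^'n) set \<Rightarrow> complex^'n \<Rightarrow> (complex^'n \<Rightarrow> bool) \<Rightarrow> bool" where
  "zariski_near X p P \<longleftrightarrow>
     (\<exists>b B. homogeneous_poly b B \<and> B p \<noteq> 0 \<and> (\<forall>q\<in>X. B q \<noteq> 0 \<longrightarrow> P q))"

text \<open>
  Smoothness of dimension \<open>d\<close> in the form ``locally standard smooth'': near each of its points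
  \<open>X\<close> is cut out by \<open>c = N - d\<close> equations whose differentials at that point are linearly
  independent.  (The real Frechet derivative of a polynomial is its complex differential.)
\<close>

definition smooth_of_dim :: "nat \<Rightarrow> (complex^'n) set \<Rightarrow> bool" where
  "smooth_of_dim d X \<longleftrightarrow>
     (\<forall>p\<in>X. \<exists>c F. CARD('n) = c + d + 1 \<and> (\<forall>i<c. \<exists>e. homogeneous_poly e (F i)) \<and>
        zariski_near {x. x \<noteq> 0} p (\<lambda>x. x \<in> X \<longleftrightarrow> (\<forall>i<c. F i x = 0)) \<and>
        (\<forall>a :: nat \<Rightarrow> complex.
           (\<forall>v. (\<Sum>i<c. a i * frechet_derivative (F i) (at p) v) = 0) \<longrightarrow> (\<forall>i<c. a i = 0)))"

definition smooth_projective_variety :: "nat \<Rightarrow> (complex^'n) set \<Rightarrow> bool" where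
  "smooth_projective_variety d X \<longleftrightarrow> projective_variety X \<and> smooth_of_dim d X"

text \<open>
  The germ of \<open>f\<close> at \<open>p\<close> is a regular section of \<open>O(m)\<close> on \<open>X\<close>; for \<open>m = 0\<close> it is an element
  of the local ring of \<open>X\<close> at \<open>p\<close>.
\<close>

definition regular_at :: "(complex^'n) set \<Rightarrow> nat \<Rightarrow> complex^'n \<Rightarrow> (complex^'n \<Rightarrow> complex) \<Rightarrow> bool"
  where
  "regular_at X m p f \<longleftrightarrow>
     (\<exists>b A B. homogeneous_poly (b + m) A \<and> homogeneous_poly b B \<and> B p \<noteq> 0 \<and>
        zariski_near X p (\<lambda>q. f q = A q / B q))"

text \<open>A morphism acts on representatives; its values matter only up to \<^const>\<open>proj_eq\<close>.\<close>

definition morphism :: "(complex^'n) set \<Rightarrow> (complex^'m) set \<Rightarrow> (complex^'n \<Rightarrow> complex^'m) \<Rightarrow> bool"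
  where
  "morphism X Y \<phi> \<longleftrightarrow>
     (\<forall>p\<in>X. \<phi> p \<in> Y \<and>
        (\<exists>d P. (\<forall>i. homogeneous_poly d (\<lambda>x. P x $ i)) \<and> P p \<noteq> 0 \<and>
           zariski_near X p (\<lambda>q. proj_eq (\<phi> q) (P q))))"

text \<open>An embedding is an isomorphism onto a closed subvariety of the projective space.\<close>

definition embedding :: "(complex^'n) set \<Rightarrow> (complex^'n \<Rightarrow> complex^'m) \<Rightarrow> bool" where
  "embedding X \<phi> \<longleftrightarrow>
     (\<exists>Y \<psi>. projective_closed Y \<and> morphism X Y \<phi> \<and> morphism Y X \<psi> \<and>
        (\<forall>p\<in>X. proj_eq (\<psi> (\<phi> p)) p) \<and> (\<forall>q\<in>Y. proj_eq (\<phi> (\<psi> q)) q))"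

text \<open>
  The germ of \<open>h\<close> generates the ideal of the closed subset \<open>Z\<close> in the local ring of \<open>X\<close> at \<open>p\<close>.
  For \<open>p \<notin> Z\<close> this ideal is the whole ring and \<open>h\<close> is a unit.
\<close>

definition local_equation ::
  "(complex^'n) set \<Rightarrow> (complex^'n) set \<Rightarrow> complex^'n \<Rightarrow> (complex^'n \<Rightarrow> complex) \<Rightarrow> bool" where
  "local_equation X Z p h \<longleftrightarrow>
     regular_at X 0 p h \<and> zariski_near X p (\<lambda>q. q \<in> Z \<longrightarrow> h q = 0) \<and>
     (\<forall>g. regular_at X 0 p g \<and> zariski_near X p (\<lambda>q. q \<in> Z \<longrightarrow> g q = 0) \<longrightarrow>
        (\<exists>e. regular_at X 0 p e \<and> zariski_near X p (\<lambda>q. g q = h q * e q)))"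

definition local_parameter :: "(complex^'m) set \<Rightarrow> complex^'m \<Rightarrow> (complex^'m \<Rightarrow> complex) \<Rightarrow> bool"
  where "local_parameter C c z \<longleftrightarrow> local_equation C {q. proj_eq q c} c z"

definition fibre ::
  "(complex^'n) set \<Rightarrow> (complex^'n \<Rightarrow> complex^'m) \<Rightarrow> complex^'m \<Rightarrow> (complex^'n) set" where
  "fibre S \<pi> c = {p \<in> S. proj_eq (\<pi> p) c}"

text \<open>
  A fibre, polarized by \<open>O(1)\<close>, is isomorphic to \<open>(P\<^sup>1, O(1))\<close> iff it is a line of \<open>P\<^sup>N\<close>.  The last
  clause says that this holds for the scheme-theoretic fibre: its ideal, generated by the
  pullback of a local parameter of the base curve, is the ideal of the (reduced) line.
\<close>

definition surface_scroll ::
  "(complex^'n) set \<Rightarrow> (complex^'m) set \<Rightarrow> (complex^'n \<Rightarrow> complex^'m) \<Rightarrow> bool" where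
  "surface_scroll S C \<pi> \<longleftrightarrow>
     smooth_projective_variety 2 S \<and> smooth_projective_variety 1 C \<and> morphism S C \<pi> \<and>
     (\<forall>c\<in>C. \<exists>p\<in>S. proj_eq (\<pi> p) c) \<and>
     (\<forall>c\<in>C.
        (\<exists>W. vec.subspace W \<and> vec.dim W = 2 \<and> fibre S \<pi> c = W - {0}) \<and>
        (\<exists>z. local_parameter C c z \<and>
           (\<forall>p\<in>fibre S \<pi> c. local_equation S (fibre S \<pi> c) p (z \<circ> \<pi>))))"

definition nondegenerate :: "(complex^'n) set \<Rightarrow> bool" where
  "nondegenerate S \<longleftrightarrow> (\<forall>a. (\<forall>x\<in>S. linear_form a x = 0) \<longrightarrow> a = 0)"

text \<open>
  For \<open>S\<close> nondegenerate the space \<open>V\<close> of hyperplane sections is the space of all linear forms,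
  identified with their coefficient vectors.  \<open>sections_minus S D t\<close> is the subspace of the
  sections vanishing on the divisor \<open>t D\<close>, where \<open>D\<close> is a curve on \<open>S\<close>.
\<close>

definition sections_minus :: "(complex^'n) set \<Rightarrow> (complex^'n) set \<Rightarrow> nat \<Rightarrow> (complex^'n) set" where
  "sections_minus S D t =
     {a. \<forall>p\<in>S. \<exists>h g. local_equation S D p h \<and> regular_at S 1 p g \<and>
            zariski_near S p (\<lambda>q. linear_form a q = h q ^ t * g q)}"

text \<open>
  \<open>\<Phi>\<close> is the map given by the sections \<open>\<sigma> i\<close> regarded as sections of \<open>L(-t D)\<close>: near \<open>p\<close> they
  are divided by the \<open>t\<close>-th power of a local equation of \<open>D\<close>, and the resulting \<open>G\<close> does not
  vanish at \<open>p\<close> (absence of base points).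
\<close>

definition defines_map ::
  "(complex^'n) set \<Rightarrow> (complex^'n) set \<Rightarrow> nat \<Rightarrow> ('m \<Rightarrow> complex^'n) \<Rightarrow>
    (complex^'n \<Rightarrow> complex^'m) \<Rightarrow> bool" where
  "defines_map S D t \<sigma> \<Phi> \<longleftrightarrow>
     (\<forall>p\<in>S. \<exists>h G. local_equation S D p h \<and> (\<forall>i. regular_at S 1 p (\<lambda>q. G q $ i)) \<and> G p \<noteq> 0 \<and>
        zariski_near S p
          (\<lambda>q. (\<forall>i. linear_form (\<sigma> i) q = h q ^ t * G q $ i) \<and> proj_eq (\<Phi> q) (G q)))"

text \<open>
  The linear system \<open>|V - t D|\<close> is very ample.  Its map is written with a spanning family of
  \<open>N + 1\<close> sections instead of a basis, because the number of elements of a basis is not a type;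
  this composes the map with a linear embedding of projective spaces.
\<close>

definition very_ample_minus :: "(complex^'n) set \<Rightarrow> (complex^'n) set \<Rightarrow> nat \<Rightarrow> bool" where
  "very_ample_minus S D t \<longleftrightarrow>
     (\<exists>(\<sigma> :: 'n \<Rightarrow> complex^'n) (\<Phi> :: complex^'n \<Rightarrow> complex^'n).
        vec.span (range \<sigma>) = sections_minus S D t \<and> defines_map S D t \<sigma> \<Phi> \<and> embedding S \<Phi>)"

text \<open>\<open>max_power_section S x j f\<close>: the germ of \<open>f\<close> lies in \<open>m\<^sub>x\<^sup>j L\<^sub>x\<close>, where \<open>L = O(1)|\<^sub>S\<close>.\<close>

primrec max_power_section ::
  "(complex^'n) set \<Rightarrow> complex^'n \<Rightarrow> nat \<Rightarrow> (complex^'n \<Rightarrow> complex) \<Rightarrow> bool" where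
  "max_power_section S x 0 f \<longleftrightarrow> regular_at S 1 x f"
| "max_power_section S x (Suc j) f \<longleftrightarrow>
     (\<exists>(n::nat) g s.
        (\<forall>i<n. regular_at S 0 x (g i) \<and> g i x = 0 \<and> max_power_section S x j (s i)) \<and>
        zariski_near S x (\<lambda>q. f q = (\<Sum>i<n. g i q * s i q)))"

text \<open>The fibre of the \<open>k\<close>-th jet bundle of \<open>L\<close> at \<open>x\<close> is \<open>L\<^sub>x / m\<^sub>x\<^sup>k\<^sup>+\<^sup>1 L\<^sub>x\<close>.\<close>

definition jet_kernel :: "(complex^'n) set \<Rightarrow> nat \<Rightarrow> complex^'n \<Rightarrow> (complex^'n) set" where
  "jet_kernel S k x = {a. max_power_section S x (k + 1) (linear_form a)}"

text \<open>
  \<open>P(V)\<close> parametrizes the codimension-one subspaces of \<open>V\<close>, the point \<open>y\<close> corresponding to the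
  space of linear forms vanishing at \<open>y\<close>.  Hence \<open>P(Im j)\<close>, for the jet map \<open>j\<close>, consists of the
  points \<open>y\<close> at which all forms in the kernel of \<open>j\<close> vanish.  The set below is the linear subspace
  of \<^typ>\<open>complex^'n\<close> whose projectivization is the osculating space.
\<close>

definition osculating_space :: "(complex^'n) set \<Rightarrow> nat \<Rightarrow> complex^'n \<Rightarrow> (complex^'n) set" where
  "osculating_space S k x = {y. \<forall>a\<in>jet_kernel S k x. linear_form a y = 0}"

definition proj_dim :: "(complex^'n) set \<Rightarrow> int" where
  "proj_dim W = int (vec.dim W) - 1"

end

theory Submission
  imports Defs "HOL-Complex_Analysis.Cauchy_Integral_Formula"
begin

text \<open>
  Let \<open>h\<close> be a local equation of the fibre \<open>D\<close> of \<open>x\<close>.  A section of \<open>V - t D\<close> divided by \<open>h\<^sup>t\<close> restricts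
  to a section of \<open>O(1)\<close> on the line \<open>D\<close>, because \<open>O(D)\<close> is trivial along a fibre.  If \<open>V - t D\<close> has
  no base points on \<open>D\<close>, then all sections of \<open>O(1)\<close> on \<open>D\<close> arise in this way, since a single linear
  form always has a zero on the line.  Very ampleness gives freeness for \<open>t \<le> k - 2\<close>.  It also
  holds for \<open>t = k - 1\<close>: the map of \<open>V - (k - 2) D\<close> is an immersion taking \<open>D\<close> to a line, so for each
  point of \<open>D\<close> some hyperplane contains this line but not the tangent plane at the point.

  With \<open>u\<close> a coordinate along \<open>D\<close>, the system thus contains sections with leading terms \<open>h\<^sup>t\<close> and
  \<open>u h\<^sup>t\<close> for all \<open>t < k\<close>.  Their orders are at most \<open>k\<close>, so their \<open>k\<close>-jets at \<open>x\<close> are independent,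
  and the jet map has rank at least \<open>2 k \<ge> k + 3\<close>.
\<close>

subsection \<open>Linear algebra\<close>

text \<open>The local rings of S are never expanded in power series in \<open>h\<close> and
  \<open>u\<close>, so independence of jets is not read off from coefficients. Real arcs in S,
  differentiable at 0, take that role. A germ in the j-th power of the maximal ideal is O(|s|^j)
  along every arc; in the other direction |h| is at least c |s| along an arc that leaves the line
  transversally, because a linear form vanishing on the line is, after dehomogenizing, locally a
  multiple of \<open>h\<close>. Arcs in all tangent directions come from the inverse function
  theorem.

  The same arcs serve in two more places: powers of \<open>h\<close> are cancelled along them, and
  an embedding is immersive in the sense that an arc made stationary by a lift of the map has radial
  velocity. That a section of O(1) on the line is the restriction of a linear form comes from
  Liouville's theorem in an affine chart. The range t < k is what \<open>k\<close>-jets can detect,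
  since u h^t has order at most t + 1.\<close>

lemma linear_form_bilinear:
  "linear_form (a + b) x = linear_form a x + linear_form b x"
  "linear_form (a - b) x = linear_form a x - linear_form b x"
  "linear_form (c *s a) x = c * linear_form a x"
  "linear_form a (x + y) = linear_form a x + linear_form a y"
  "linear_form a (x - y) = linear_form a x - linear_form a y"
  "linear_form a (c *s x) = c * linear_form a x"
  "linear_form 0 x = 0" "linear_form a 0 = 0"
  by (simp_all add: linear_form_def sum.distrib sum_subtractf sum_distrib_left algebra_simps)

lemma scaleR_vec_conv_vector_scalar_mult: "r *\<^sub>R (v :: complex^'n) = complex_of_real r *s v"
  by (simp add: vec_eq_iff) (simp add: scaleR_conv_of_real)

lemma linear_form_scaleR:
  "linear_form (r *\<^sub>R a) x = r *\<^sub>R linear_form a x"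
  "linear_form a (r *\<^sub>R x) = r *\<^sub>R linear_form a x"
  by (simp_all add: scaleR_vec_conv_vector_scalar_mult linear_form_bilinear scaleR_conv_of_real)

lemma linear_form_sum: "linear_form (\<Sum>i\<in>I. a i) x = (\<Sum>i\<in>I. linear_form (a i) x)"
  by (induction I rule: infinite_finite_induct) (simp_all add: linear_form_bilinear)

lemma linear_form_axis: "linear_form (axis i 1) x = x $ i"
  by (simp add: linear_form_def axis_def if_distrib[of "\<lambda>y. y * _"] cong: if_cong)

lemma linear_form_commute: "linear_form a x = linear_form x a"
  by (simp add: linear_form_def mult.commute)

lemma bounded_bilinear_linear_form:
  "bounded_bilinear (linear_form :: complex^'n \<Rightarrow> complex^'n \<Rightarrow> complex)"
  unfolding bilinear_conv_bounded_bilinear[symmetric] bilinear_def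
  by (auto intro!: linearI simp: linear_form_bilinear linear_form_scaleR)

lemma bounded_bilinear_vector_scalar_mult:
  "bounded_bilinear ((*s) :: complex \<Rightarrow> complex^'n \<Rightarrow> complex^'n)"
  unfolding bilinear_conv_bounded_bilinear[symmetric] bilinear_def
  by (auto intro!: linearI simp: vec_eq_iff algebra_simps)

lemmas bounded_linear_linear_form =
  bounded_bilinear.bounded_linear_right[OF bounded_bilinear_linear_form]

lemma linear_form_has_derivative: "(linear_form a has_derivative linear_form a) F"
  using bounded_linear_linear_form by (rule bounded_linear_imp_has_derivative)

lemma linear_functional_eq_linear_form:
  fixes f :: "complex^'n \<Rightarrow> complex"
  assumes "Vector_Spaces.linear (*s) (*) f"
  shows "\<exists>a. f = linear_form a"
proof -
  interpret Vector_Spaces.linear "(*s)" "(*)" f by fact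
  have "f v = linear_form (\<chi> i. f (axis i 1)) v" for v
  proof -
    have "f v = f (\<Sum>i\<in>UNIV. v $ i *s axis i 1)"
      by (simp add: basis_expansion)
    also have "\<dots> = (\<Sum>i\<in>UNIV. v $ i * f (axis i 1))"
      by (simp add: sum scale)
    finally show ?thesis by (simp add: linear_form_def mult.commute)
  qed
  then show ?thesis by blast
qed

lemma exists_linear_form_vanishing_on_subspace:
  fixes W :: "(complex^'n) set"
  assumes "vec.subspace W" "w \<notin> W"
  shows "\<exists>a. (\<forall>y\<in>W. linear_form a y = 0) \<and> linear_form a w = 1"
proof -
  obtain B where B: "B \<subseteq> W" "vec.independent B" "vec.span B = W"
    by (metis assms(1) vec.basis_exists vec.span_eq vec.subspace_def vec.span_minimal vec.span_mono
        subset_antisym vec.span_eq_iff)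
  have ind: "vec.independent (insert w B)"
    using B assms by (simp add: vec.independent_insertI)
  interpret P: vector_space_pair "(*s) :: complex \<Rightarrow> complex^'n \<Rightarrow> _" "(*) :: complex \<Rightarrow> complex \<Rightarrow> complex"
    by unfold_locales
  obtain f where f: "Vector_Spaces.linear (*s) (*) f" "\<forall>b\<in>insert w B. f b = (if b = w then 1 else 0)"
    using P.linear_independent_extend[OF ind, of "\<lambda>b. if b = w then 1 else 0"] by blast
  interpret f: Vector_Spaces.linear "(*s)" "(*)" f by (rule f)
  obtain a where a: "f = linear_form a" using linear_functional_eq_linear_form f by blast
  have "f y = 0" if "y \<in> W" for y
  proof -
    have "B \<subseteq> {y. f y = 0}" using f B assms by auto
    moreover have "vec.subspace {y. f y = 0}"
      by (auto intro!: vec.subspaceI simp: f.add f.scale f.zero)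
    ultimately show ?thesis using vec.span_minimal B that by blast
  qed
  then show ?thesis using a f by auto
qed

lemma linear_form_separates: "w \<noteq> 0 \<Longrightarrow> \<exists>a. linear_form a w = 1"
  using exists_linear_form_vanishing_on_subspace[of "{0}" w] by auto

text \<open>Each further form costs at most one dimension: a vector \<open>v\<close> of the old
  kernel on which it is nonzero spans, together with the new kernel, the old one. This bounds both
  the tangent space of the cone and the osculating space from below.\<close>

lemma dim_annihilator_ge:
  fixes B :: "(complex^'n) set"
  assumes "finite B"
  shows "CARD('n) \<le> vec.dim {y. \<forall>a\<in>B. linear_form a y = 0} + card B"
  using assms
proof (induction B)
  case empty
  have "vec.dim (UNIV :: (complex^'n) set) = CARD('n)" by (rule vec_dim_card)
  then show ?case by simp
next
  case (insert b B)
  let ?K = "{y. \<forall>a\<in>B. linear_form a y = 0}" and ?L = "{y. \<forall>a\<in>insert b B. linear_form a y = 0}"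
  have "vec.dim ?K \<le> vec.dim ?L + 1"
  proof (cases "\<exists>v\<in>?K. linear_form b v \<noteq> 0")
    case True
    then obtain v where v: "v \<in> ?K" "linear_form b v \<noteq> 0" by blast
    have "?K \<subseteq> vec.span (insert v ?L)"
    proof
      fix y assume y: "y \<in> ?K"
      have "y - (linear_form b y / linear_form b v) *s v \<in> ?L"
        using y v by (auto simp: linear_form_bilinear)
      then show "y \<in> vec.span (insert v ?L)"
        by (auto intro!: vec.span_base simp: vec.span_insert)
    qed
    then have "vec.dim ?K \<le> vec.dim (insert v ?L)" by (rule vec.dim_mono)
    then show ?thesis by (auto simp: vec.dim_insert split: if_splits)
  next
    case False
    then have "?L = ?K" by auto
    then show ?thesis by simp
  qed
  then show ?case using insert by simp
qed

text \<open>Independent forms have a dual family, built one form at a time: a vector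
  \<open>w\<close> dual to the new form is found in the common kernel of the old ones, and the old
  dual vectors are then corrected by multiples of \<open>w\<close>.\<close>

lemma exists_dual_family:
  fixes g :: "nat \<Rightarrow> complex^'n"
  assumes "\<And>a. (\<forall>v. (\<Sum>i<c. a i * linear_form (g i) v) = 0) \<Longrightarrow> \<forall>i<c. a i = 0"
  shows "\<exists>r. \<forall>i<c. \<forall>j<c. linear_form (g i) (r j) = (if i = j then 1 else 0)"
  using assms
proof (induction c)
  case (Suc c)
  have "\<exists>r. \<forall>i<c. \<forall>j<c. linear_form (g i) (r j) = (if i = j then 1 else 0)"
  proof (rule Suc.IH)
    fix a assume "\<forall>v. (\<Sum>i<c. a i * linear_form (g i) v) = 0"
    then have "\<forall>i<Suc c. (a(c := 0)) i = 0"
      by (intro Suc.prems) auto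
    then show "\<forall>i<c. a i = 0" by (metis fun_upd_apply less_Suc_eq nat_neq_iff)
  qed
  then obtain r where r: "\<And>i j. i < c \<Longrightarrow> j < c \<Longrightarrow> linear_form (g i) (r j) = (if i = j then 1 else 0)"
    by blast
  \<comment> \<open>With these coefficients the combination of forms evaluated at \<open>v\<close>
    is exactly the value of \<open>linear_form (g c)\<close> at the projection \<open>u\<close> of
    \<open>v\<close> to the kernel of the earlier forms. Since \<open>a c = 1\<close>, the
    combination is nontrivial and some \<open>v\<close> detects it.\<close>
  define a where "a i = (if i = c then 1 else - linear_form (g c) (r i))" for i
  have "\<not> (\<forall>i<Suc c. a i = 0)" by (auto simp: a_def)
  then obtain v where v: "(\<Sum>i<Suc c. a i * linear_form (g i) v) \<noteq> 0"
    using Suc.prems by blast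
  define u where "u = v - (\<Sum>i<c. linear_form (g i) v *s r i)"
  have lu: "linear_form b u = linear_form b v - (\<Sum>j<c. linear_form (g j) v * linear_form b (r j))" for b
    unfolding u_def linear_form_bilinear linear_form_commute[of b] linear_form_sum ..
  have u0: "linear_form (g i) u = 0" if "i < c" for i
  proof -
    have "(\<Sum>j<c. linear_form (g j) v * linear_form (g i) (r j)) =
        (\<Sum>j<c. if j = i then linear_form (g j) v else 0)"
      by (rule sum.cong) (use that r in auto)
    then show ?thesis using that unfolding lu by simp
  qed
  have uc: "linear_form (g c) u \<noteq> 0"
    using v unfolding lu by (simp add: a_def sum_negf algebra_simps)
  define w where "w = (1 / linear_form (g c) u) *s u"
  have wc: "linear_form (g c) w = 1" using uc by (simp add: w_def linear_form_bilinear)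
  have w0: "linear_form (g i) w = 0" if "i < c" for i
    using u0[OF that] by (simp add: w_def linear_form_bilinear)
  let ?r = "\<lambda>j. if j = c then w else r j - linear_form (g c) (r j) *s w"
  have "linear_form (g i) (?r j) = (if i = j then 1 else 0)" if "i < Suc c" "j < Suc c" for i j
  proof (cases "i = c"; cases "j = c")
    assume "i = c" "j = c" then show ?thesis using wc by simp
  next
    assume "i = c" "j \<noteq> c" then show ?thesis using wc by (simp add: linear_form_bilinear)
  next
    assume "i \<noteq> c" "j = c" then show ?thesis using w0 that by simp
  next
    assume "i \<noteq> c" "j \<noteq> c" then show ?thesis
      using w0[of i] r[of i j] that by (simp add: linear_form_bilinear)
  qed
  then show ?case by (intro exI[of _ ?r]) blast
qed auto

lemma two_dimensional_subspace:
  fixes W :: "(complex^'n) set"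
  assumes "vec.subspace W" "vec.dim W = 2" "p \<in> W" "p \<noteq> 0"
  shows "\<exists>q\<in>W. (\<forall>\<alpha> \<beta>. \<alpha> *s p + \<beta> *s q = 0 \<longrightarrow> \<alpha> = 0 \<and> \<beta> = 0) \<and> W = {\<alpha> *s p + \<beta> *s q |\<alpha> \<beta>. True}"
proof -
  have "\<not> W \<subseteq> vec.span {p}"
  proof
    assume "W \<subseteq> vec.span {p}"
    then have "vec.dim W \<le> vec.dim {p}" by (rule vec.dim_mono)
    then show False using assms by simp
  qed
  then obtain q where q: "q \<in> W" "q \<notin> vec.span {p}" by blast
  have ind: "\<alpha> = 0 \<and> \<beta> = 0" if eq: "\<alpha> *s p + \<beta> *s q = 0" for \<alpha> \<beta>
  proof -
    have "\<beta> = 0"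
    proof (rule ccontr)
      assume b: "\<beta> \<noteq> 0"
      have "q = (- \<alpha> / \<beta>) *s p"
      proof -
        have "\<beta> *s q = (- \<alpha>) *s p" using eq by (simp add: add_eq_0_iff)
        then have "(1 / \<beta>) *s (\<beta> *s q) = (1 / \<beta>) *s ((- \<alpha>) *s p)" by simp
        then show ?thesis using b by (simp add: vector_smult_assoc)
      qed
      then show False using q by (metis vec.span_base vec.span_scale singletonI)
    qed
    then show ?thesis using eq assms by simp
  qed
  have "vec.independent {p, q}"
    using q assms(4) by (simp add: insert_commute[of p q] vec.independent_insert)
  moreover have "card {p, q} = 2" using q vec.span_base by (force simp: card_insert_if)
  ultimately have "W \<subseteq> vec.span {p, q}"
    using vec.card_ge_dim_independent[of "{p, q}" W] assms q by simp
  have "W \<subseteq> {\<alpha> *s p + \<beta> *s q |\<alpha> \<beta>. True}"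
  proof
    fix y assume "y \<in> W"
    then obtain \<alpha> \<beta> where "y - \<alpha> *s p = \<beta> *s q"
      using \<open>W \<subseteq> vec.span {p, q}\<close> by (force simp: vec.span_insert[of p] vec.span_singleton)
    then have "y = \<alpha> *s p + \<beta> *s q" by (simp add: diff_eq_eq add.commute)
    then show "y \<in> {\<alpha> *s p + \<beta> *s q |\<alpha> \<beta>. True}" by blast
  qed
  moreover have "{\<alpha> *s p + \<beta> *s q |\<alpha> \<beta>. True} \<subseteq> W"
    using assms q by (auto intro!: vec.subspace_add vec.subspace_scale)
  ultimately show ?thesis using q ind by blast
qed

text \<open>The hypothesis \<open>ind\<close> is independence of the vectors \<open>e i\<close>
  modulo \<open>K\<close>, so each of them leaves the span of \<open>K\<close> and the preceding
  ones. In the induction this span is enclosed in the explicit subspace \<open>?M\<close>, where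
  membership of \<open>e i\<close> reads as a forbidden relation.\<close>

lemma card_plus_dim_le:
  fixes K :: "(complex^'n) set" and e :: "'i \<Rightarrow> complex^'n"
  assumes "finite I" "vec.subspace K"
    and ind: "\<And>c. (\<Sum>i\<in>I. c i *s e i) \<in> K \<Longrightarrow> \<forall>i\<in>I. c i = 0"
  shows "card I + vec.dim K \<le> CARD('n)"
proof -
  have "card I + vec.dim K \<le> vec.dim (K \<union> e ` I)"
    using assms(1) ind
  proof (induction I)
    case (insert i I)
    have IH: "card I + vec.dim K \<le> vec.dim (K \<union> e ` I)"
    proof (rule insert.IH)
      fix c assume c: "(\<Sum>j\<in>I. c j *s e j) \<in> K"
      have "(\<Sum>j\<in>insert i I. (c(i := 0)) j *s e j) = (\<Sum>j\<in>I. c j *s e j)"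
        using insert.hyps by (simp, intro sum.cong) auto
      with c have "\<forall>j\<in>insert i I. (c(i := 0)) j = 0" by (intro insert.prems) (simp only:)
      show "\<forall>j\<in>I. c j = 0"
      proof
        fix j assume "j \<in> I"
        then have "j \<noteq> i" "(c(i := 0)) j = 0"
          using insert.hyps \<open>\<forall>j\<in>insert i I. (c(i := 0)) j = 0\<close> by auto
        then show "c j = 0" by simp
      qed
    qed
    let ?M = "{y. \<exists>c. y - (\<Sum>j\<in>I. c j *s e j) \<in> K}"
    have "vec.subspace ?M"
    proof (rule vec.subspaceI)
      show "0 \<in> ?M" using vec.subspace_0[OF assms(2)] by (auto intro!: exI[of _ "\<lambda>_. 0"])
      show "y + z \<in> ?M" if yz: "y \<in> ?M" "z \<in> ?M" for y z
      proof -
        obtain c d where "y - (\<Sum>j\<in>I. c j *s e j) \<in> K" "z - (\<Sum>j\<in>I. d j *s e j) \<in> K"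
          using yz by blast
        from vec.subspace_add[OF assms(2) this] show ?thesis
          by (auto intro!: exI[of _ "\<lambda>j. c j + d j"] simp: sum.distrib algebra_simps)
      qed
      show "r *s y \<in> ?M" if y: "y \<in> ?M" for r y
      proof -
        obtain c where "y - (\<Sum>j\<in>I. c j *s e j) \<in> K" using y by blast
        from vec.subspace_scale[OF assms(2) this, of r] show ?thesis
          by (auto intro!: exI[of _ "\<lambda>j. r * c j"]
              simp: vec.scale_right_diff_distrib vec.scale_sum_right vector_smult_assoc)
      qed
    qed
    moreover have "K \<union> e ` I \<subseteq> ?M"
    proof
      fix y assume "y \<in> K \<union> e ` I"
      then show "y \<in> ?M"
      proof
        assume "y \<in> K"
        then show ?thesis by (auto intro!: exI[of _ "\<lambda>_. 0"])
      next
        assume "y \<in> e ` I"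
        then obtain l where l: "l \<in> I" "y = e l" by blast
        have "(\<Sum>j\<in>I. (if j = l then 1 else 0) *s e j) = (\<Sum>j\<in>I. if j = l then e j else 0)"
          by (rule sum.cong) auto
        then have "y - (\<Sum>j\<in>I. (if j = l then 1 else 0) *s e j) = 0"
          using l insert.hyps by simp
        then show ?thesis using vec.subspace_0[OF assms(2)]
          by (intro CollectI exI[of _ "\<lambda>j. if j = l then 1 else 0"]) simp
      qed
    qed
    ultimately have span: "vec.span (K \<union> e ` I) \<subseteq> ?M" by (simp add: vec.span_minimal)
    have "e i \<notin> vec.span (K \<union> e ` I)"
    proof
      assume "e i \<in> vec.span (K \<union> e ` I)"
      then obtain c where c: "e i - (\<Sum>j\<in>I. c j *s e j) \<in> K" using span by blast
      let ?c = "\<lambda>j. if j = i then 1 else - c j"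
      have "(\<Sum>j\<in>I. ?c j *s e j) = (\<Sum>j\<in>I. - (c j *s e j))"
        using insert.hyps by (intro sum.cong) auto
      then have "(\<Sum>j\<in>insert i I. ?c j *s e j) = e i - (\<Sum>j\<in>I. c j *s e j)"
        using insert.hyps by (simp add: sum_negf)
      then show False using insert.prems[of ?c] c by auto
    qed
    then show ?case using IH insert.hyps by (simp add: vec.dim_insert)
  qed simp
  also have "\<dots> \<le> vec.dim (UNIV :: (complex^'n) set)" by (rule vec.dim_subset) simp
  finally show ?thesis by (simp only: vec_dim_card)
qed

subsection \<open>Regular germs\<close>

lemma homogeneous_poly_scale: "homogeneous_poly d F \<Longrightarrow> F (c *s x) = c ^ d * F x"
  by (induction rule: homogeneous_poly.induct) (auto simp: algebra_simps power_add)

lemma homogeneous_poly_cmult: "homogeneous_poly d F \<Longrightarrow> homogeneous_poly d (\<lambda>x. c * F x)"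
  using homogeneous_poly.mult[OF homogeneous_poly.const] by fastforce

lemma homogeneous_poly_linear_form_comp:
  fixes P :: "complex^'n \<Rightarrow> complex^'m"
  assumes "\<And>i. homogeneous_poly d (\<lambda>x. P x $ i)"
  shows "homogeneous_poly d (\<lambda>x. linear_form a (P x))"
proof -
  have "homogeneous_poly d (\<lambda>x. \<Sum>i\<in>I. a $ i * P x $ i)" if "finite I" for I
    using that
  proof (induction I)
    case empty
    show ?case using homogeneous_poly_cmult[OF assms, of 0] by simp
  next
    case (insert i I)
    then show ?case by (simp add: homogeneous_poly.add homogeneous_poly_cmult[OF assms])
  qed
  then show ?thesis by (simp add: linear_form_def)
qed

lemma homogeneous_poly_linear_form: "homogeneous_poly 1 (linear_form a)"
  by (rule homogeneous_poly_linear_form_comp[where P = "\<lambda>x. x"]) (rule homogeneous_poly.coord)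

text \<open>Writing the real derivative as \<open>linear_form (D x)\<close> records that it is
  complex linear; continuity of \<open>D\<close> is what the inverse function theorem will ask
  for.\<close>

lemma homogeneous_poly_has_derivative:
  assumes "homogeneous_poly d F"
  shows "\<exists>D. continuous_on UNIV D \<and> (\<forall>x. (F has_derivative linear_form (D x)) (at x))"
  using assms
proof (induction rule: homogeneous_poly.induct)
  case (const c)
  then show ?case by (intro exI[of _ "\<lambda>_. 0"]) (simp add: linear_form_bilinear(7)[abs_def])
next
  case (coord i)
  have "(\<lambda>x. x $ i) = linear_form (axis i 1)" by (simp add: linear_form_axis fun_eq_iff)
  then show ?case
    by (intro exI[of _ "\<lambda>_. axis i 1"]) (simp add: linear_form_has_derivative)
next
  case (add d p q)
  then obtain D E where "continuous_on UNIV D" "continuous_on UNIV E"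
    "\<And>x. (p has_derivative linear_form (D x)) (at x)" "\<And>x. (q has_derivative linear_form (E x)) (at x)"
    by blast
  then show ?case
    by (intro exI[of _ "\<lambda>x. D x + E x"] conjI allI continuous_on_add
          has_derivative_eq_rhs[OF has_derivative_add])
      (auto simp: linear_form_bilinear)
next
  case (mult d p e q)
  then obtain D E where D: "continuous_on UNIV D" "continuous_on UNIV E"
    "\<And>x. (p has_derivative linear_form (D x)) (at x)" "\<And>x. (q has_derivative linear_form (E x)) (at x)"
    by blast
  have "continuous_on UNIV p" "continuous_on UNIV q"
    using has_derivative_continuous_on[OF D(3)] has_derivative_continuous_on[OF D(4)] by simp_all
  then show ?case using D
    by (intro exI[of _ "\<lambda>x. p x *s E x + q x *s D x"] conjI allI continuous_on_add
          bounded_bilinear.continuous_on[OF bounded_bilinear_vector_scalar_mult]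
          has_derivative_eq_rhs[OF has_derivative_mult])
      (auto simp: linear_form_bilinear algebra_simps)
qed

lemma homogeneous_poly_continuous:
  assumes "homogeneous_poly d F"
  shows "continuous_on UNIV F"
proof -
  obtain D where "\<And>x. (F has_derivative linear_form (D x)) (at x)"
    using homogeneous_poly_has_derivative[OF assms] by blast
  from has_derivative_continuous_on[OF this] show ?thesis .
qed

lemma proj_eq_sym: "proj_eq u v \<Longrightarrow> proj_eq v u"
proof -
  assume "proj_eq u v"
  then obtain c where "c \<noteq> 0" "u = c *s v" unfolding proj_eq_def by blast
  then show ?thesis unfolding proj_eq_def
    by (intro exI[of _ "1 / c"]) (simp add: vector_smult_assoc)
qed

lemma proj_eq_trans: "proj_eq u v \<Longrightarrow> proj_eq v w \<Longrightarrow> proj_eq u w"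
  unfolding proj_eq_def by (metis mult_eq_0_iff vector_smult_assoc)

lemma proj_eq_homogeneous_poly:
  assumes "\<And>i. homogeneous_poly d (\<lambda>x. P x $ i)" "proj_eq u v"
  shows "proj_eq (P u) (P v)"
proof -
  obtain c where c: "c \<noteq> 0" "u = c *s v" using assms(2) unfolding proj_eq_def by blast
  have "P u = c ^ d *s P v"
    using homogeneous_poly_scale[OF assms(1), of c v] by (simp add: c vec_eq_iff)
  then show ?thesis unfolding proj_eq_def using c by (intro exI[of _ "c ^ d"]) simp
qed

lemma proj_eq_homogeneous_poly_nonzero:
  assumes "homogeneous_poly b B" "proj_eq u v"
  shows "B u \<noteq> 0 \<longleftrightarrow> B v \<noteq> 0"
proof -
  obtain c where c: "c \<noteq> 0" "u = c *s v" using assms(2) unfolding proj_eq_def by blast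
  then show ?thesis using homogeneous_poly_scale[OF assms(1), of c v] by simp
qed

lemma zariski_near_conj:
  assumes "zariski_near X p P" "zariski_near X p Q"
  shows "zariski_near X p (\<lambda>q. P q \<and> Q q)"
proof -
  obtain b B c C where "homogeneous_poly b B" "B p \<noteq> 0" "\<forall>q\<in>X. B q \<noteq> 0 \<longrightarrow> P q"
    "homogeneous_poly c C" "C p \<noteq> 0" "\<forall>q\<in>X. C q \<noteq> 0 \<longrightarrow> Q q"
    using assms unfolding zariski_near_def by blast
  then show ?thesis unfolding zariski_near_def
    by (intro exI[of _ "b + c"] exI[of _ "\<lambda>q. B q * C q"]) (simp add: homogeneous_poly.mult)
qed

lemma zariski_near_mono:
  "zariski_near X p P \<Longrightarrow> (\<And>q. q \<in> X \<Longrightarrow> P q \<Longrightarrow> Q q) \<Longrightarrow> zariski_near X p Q"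
  unfolding zariski_near_def by blast

lemma zariski_near_mono2:
  "zariski_near X p P \<Longrightarrow> zariski_near X p Q \<Longrightarrow> (\<And>q. q \<in> X \<Longrightarrow> P q \<Longrightarrow> Q q \<Longrightarrow> R q) \<Longrightarrow>
    zariski_near X p R"
  using zariski_near_mono[OF zariski_near_conj] by blast

lemma zariski_near_all: "(\<And>q. q \<in> X \<Longrightarrow> P q) \<Longrightarrow> zariski_near X p P"
  unfolding zariski_near_def
  by (intro exI[of _ 0] exI[of _ "\<lambda>_. 1"]) (auto intro: homogeneous_poly.const)

lemma zariski_near_at: "zariski_near X p P \<Longrightarrow> p \<in> X \<Longrightarrow> P p"
  unfolding zariski_near_def by blast

lemma zariski_near_nonzero:
  "homogeneous_poly b B \<Longrightarrow> B p \<noteq> 0 \<Longrightarrow> zariski_near X p (\<lambda>q. B q \<noteq> 0)"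
  unfolding zariski_near_def by blast

lemma zariski_near_open: "zariski_near X p P \<Longrightarrow> zariski_near X p (\<lambda>q. zariski_near X q P)"
  unfolding zariski_near_def by blast

lemma zariski_near_scale:
  "zariski_near X p P \<Longrightarrow> c \<noteq> 0 \<Longrightarrow> zariski_near X (c *s p) P"
  unfolding zariski_near_def by (metis homogeneous_poly_scale mult_eq_0_iff power_not_zero)

text \<open>Polynomials are continuous, so Zariski neighbourhoods are neighbourhoods in the
  classical topology. This is the passage from germs to limits and derivatives.\<close>

lemma zariski_near_eventually:
  assumes "zariski_near X p P"
  shows "\<forall>\<^sub>F q in nhds p. q \<in> X \<longrightarrow> P q"
proof -
  obtain b B where B: "homogeneous_poly b B" "B p \<noteq> 0" "\<forall>q\<in>X. B q \<noteq> 0 \<longrightarrow> P q"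
    using assms unfolding zariski_near_def by blast
  have "open {q. B q \<noteq> 0}"
    using homogeneous_poly_continuous[OF B(1)] by (intro open_Collect_neq) auto
  then have "\<forall>\<^sub>F q in nhds p. q \<in> {q. B q \<noteq> 0}" using B by (intro eventually_nhds_in_open) auto
  then show ?thesis by eventually_elim (use B in auto)
qed

lemma regular_at_poly: "homogeneous_poly m F \<Longrightarrow> regular_at X m p F"
  unfolding regular_at_def
  by (intro exI[of _ 0] exI[of _ F] exI[of _ "\<lambda>_. 1"])
    (auto intro: homogeneous_poly.const zariski_near_all)

lemma regular_at_const: "regular_at X 0 p (\<lambda>_. c)"
  by (rule regular_at_poly) (rule homogeneous_poly.const)

lemma regular_at_linear_form: "regular_at X 1 p (linear_form a)"
  by (rule regular_at_poly) (rule homogeneous_poly_linear_form)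

lemma regular_at_mult:
  assumes "regular_at X m p f" "regular_at X l p g"
  shows "regular_at X (m + l) p (\<lambda>q. f q * g q)"
proof -
  obtain b A B where B: "homogeneous_poly (b + m) A" "homogeneous_poly b B" "B p \<noteq> 0"
    "zariski_near X p (\<lambda>q. f q = A q / B q)"
    using assms(1) unfolding regular_at_def by blast
  obtain c G C where C: "homogeneous_poly (c + l) G" "homogeneous_poly c C" "C p \<noteq> 0"
    "zariski_near X p (\<lambda>q. g q = G q / C q)"
    using assms(2) unfolding regular_at_def by blast
  have "homogeneous_poly ((b + c) + (m + l)) (\<lambda>q. A q * G q)"
    using homogeneous_poly.mult[OF B(1) C(1)] by (simp add: algebra_simps)
  moreover have "zariski_near X p (\<lambda>q. f q * g q = (A q * G q) / (B q * C q))"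
    using B(4) C(4) by (rule zariski_near_mono2) simp
  ultimately show ?thesis unfolding regular_at_def
    using homogeneous_poly.mult[OF B(2) C(2)] B(3) C(3)
    by (intro exI[of _ "b + c"] exI[of _ "\<lambda>q. A q * G q"] exI[of _ "\<lambda>q. B q * C q"]) simp
qed

lemma regular_at_add:
  assumes "regular_at X m p f" "regular_at X m p g"
  shows "regular_at X m p (\<lambda>q. f q + g q)"
proof -
  obtain b A B where B: "homogeneous_poly (b + m) A" "homogeneous_poly b B" "B p \<noteq> 0"
    "zariski_near X p (\<lambda>q. f q = A q / B q)"
    using assms(1) unfolding regular_at_def by blast
  obtain c G C where C: "homogeneous_poly (c + m) G" "homogeneous_poly c C" "C p \<noteq> 0"
    "zariski_near X p (\<lambda>q. g q = G q / C q)"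
    using assms(2) unfolding regular_at_def by blast
  have "homogeneous_poly ((b + c) + m) (\<lambda>q. A q * C q)"
    using homogeneous_poly.mult[OF B(1) C(2)] by (simp add: algebra_simps)
  moreover have "homogeneous_poly ((b + c) + m) (\<lambda>q. G q * B q)"
    using homogeneous_poly.mult[OF C(1) B(2)] by (simp add: algebra_simps)
  ultimately have "homogeneous_poly ((b + c) + m) (\<lambda>q. A q * C q + G q * B q)"
    by (rule homogeneous_poly.add)
  moreover have "zariski_near X p (\<lambda>q. (f q = A q / B q \<and> g q = G q / C q) \<and> (B q \<noteq> 0 \<and> C q \<noteq> 0))"
    by (intro zariski_near_conj B(4) C(4) zariski_near_nonzero[OF B(2,3)] zariski_near_nonzero[OF C(2,3)])
  then have "zariski_near X p (\<lambda>q. f q + g q = (A q * C q + G q * B q) / (B q * C q))"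
    by (rule zariski_near_mono) (auto simp: field_simps)
  ultimately show ?thesis unfolding regular_at_def
    using homogeneous_poly.mult[OF B(2) C(2)] B(3) C(3)
    by (intro exI[of _ "b + c"] exI[of _ "\<lambda>q. A q * C q + G q * B q"] exI[of _ "\<lambda>q. B q * C q"]) simp
qed

lemma regular_at_cmult: "regular_at X m p f \<Longrightarrow> regular_at X m p (\<lambda>q. c * f q)"
  using regular_at_mult[OF regular_at_const] by fastforce

lemma regular_at_power: "regular_at X 0 p f \<Longrightarrow> regular_at X 0 p (\<lambda>q. f q ^ t)"
proof (induction t)
  case 0
  then show ?case by (simp add: regular_at_const)
next
  case (Suc t)
  then show ?case using regular_at_mult[of X 0 p f 0 "\<lambda>q. f q ^ t"] by simp
qed

lemma regular_at_divide_linear_form: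
  assumes "regular_at X 1 p f" "linear_form m p \<noteq> 0"
  shows "regular_at X 0 p (\<lambda>q. f q / linear_form m q)"
proof -
  obtain b A B where B: "homogeneous_poly (b + 1) A" "homogeneous_poly b B" "B p \<noteq> 0"
    "zariski_near X p (\<lambda>q. f q = A q / B q)"
    using assms(1) unfolding regular_at_def by blast
  have "zariski_near X p (\<lambda>q. f q / linear_form m q = A q / (B q * linear_form m q))"
    using B(4) by (rule zariski_near_mono) simp
  then show ?thesis unfolding regular_at_def
    using homogeneous_poly.mult[OF B(2) homogeneous_poly_linear_form[of m]] B assms(2)
    by (intro exI[of _ "b + 1"] exI[of _ A] exI[of _ "\<lambda>q. B q * linear_form m q"]) simp
qed

lemma regular_at_open:
  assumes "regular_at X m p f"
  shows "zariski_near X p (\<lambda>q. regular_at X m q f)"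
proof -
  obtain b A B where B: "homogeneous_poly (b + m) A" "homogeneous_poly b B" "B p \<noteq> 0"
    "zariski_near X p (\<lambda>q. f q = A q / B q)"
    using assms(1) unfolding regular_at_def by blast
  from zariski_near_open[OF B(4)] zariski_near_nonzero[OF B(2,3)] show ?thesis
    by (rule zariski_near_mono2) (use B in \<open>auto simp: regular_at_def\<close>)
qed

lemma regular_at_scale:
  assumes "regular_at X m p f" "c \<noteq> 0"
  shows "regular_at X m (c *s p) f"
proof -
  obtain b A B where B: "homogeneous_poly (b + m) A" "homogeneous_poly b B" "B p \<noteq> 0"
    "zariski_near X p (\<lambda>q. f q = A q / B q)"
    using assms(1) unfolding regular_at_def by blast
  moreover have "B (c *s p) \<noteq> 0" using B assms by (simp add: homogeneous_poly_scale)
  ultimately show ?thesis using zariski_near_scale[OF B(4) assms(2)] unfolding regular_at_def by blast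
qed

lemma regular_at_homogeneous:
  assumes "regular_at X m p f" "c \<noteq> 0" "p \<in> X" "c *s p \<in> X"
  shows "f (c *s p) = c ^ m * f p"
proof -
  obtain b A B where B: "homogeneous_poly (b + m) A" "homogeneous_poly b B" "B p \<noteq> 0"
    "zariski_near X p (\<lambda>q. f q = A q / B q)"
    using assms(1) unfolding regular_at_def by blast
  have "f p = A p / B p" "f (c *s p) = A (c *s p) / B (c *s p)"
    using zariski_near_at B(4) assms zariski_near_scale by blast+
  then show ?thesis using assms B
    by (simp add: homogeneous_poly_scale[OF B(1)] homogeneous_poly_scale[OF B(2)] power_add)
qed

text \<open>A regular germ is controlled only on \<open>X\<close>, hence has no ambient derivative
  of its own. The quotient of polynomials that represents it is an ambient extension
  \<open>\<phi>\<close> that does.\<close>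

lemma regular_at_has_derivative:
  assumes "regular_at X m p f"
  shows "\<exists>\<phi> D. (\<phi> has_derivative linear_form D) (at p) \<and> (\<forall>\<^sub>F q in nhds p. q \<in> X \<longrightarrow> f q = \<phi> q)"
proof -
  obtain b A B where B: "homogeneous_poly (b + m) A" "homogeneous_poly b B" "B p \<noteq> 0"
    "zariski_near X p (\<lambda>q. f q = A q / B q)"
    using assms(1) unfolding regular_at_def by blast
  obtain D where D: "(A has_derivative linear_form D) (at p)"
    using homogeneous_poly_has_derivative[OF B(1)] by blast
  obtain E where E: "(B has_derivative linear_form E) (at p)"
    using homogeneous_poly_has_derivative[OF B(2)] by blast
  from has_derivative_divide[OF D E B(3)]
  have "((\<lambda>q. A q / B q) has_derivative
      linear_form ((- A p * inverse (B p) * inverse (B p)) *s E + (1 / B p) *s D)) (at p)"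
    by (rule has_derivative_eq_rhs) (simp add: fun_eq_iff linear_form_bilinear divide_inverse)
  then show ?thesis using zariski_near_eventually[OF B(4)] by blast
qed

lemma local_equation_regular_at: "local_equation X Z p h \<Longrightarrow> regular_at X 0 p h"
  by (simp add: local_equation_def)

lemma local_equation_associate:
  assumes "local_equation X Z p h" "local_equation X Z p h'"
  shows "\<exists>e. regular_at X 0 p e \<and> zariski_near X p (\<lambda>q. h' q = h q * e q)"
  using assms unfolding local_equation_def by blast

subsection \<open>Arcs on smooth varieties\<close>

lemma has_vector_derivative_vec:
  fixes f :: "real \<Rightarrow> complex^'n"
  assumes "\<And>i. ((\<lambda>s. f s $ i) has_vector_derivative D $ i) (at t)"
  shows "(f has_vector_derivative D) (at t)"
proof -
  have "((\<lambda>s. \<Sum>i\<in>UNIV. f s $ i *s axis i 1) has_vector_derivative (\<Sum>i\<in>UNIV. D $ i *s axis i 1)) (at t)"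
    by (intro has_vector_derivative_sum assms bounded_linear.has_vector_derivative[OF
          bounded_bilinear.bounded_linear_left[OF bounded_bilinear_vector_scalar_mult]])
  then show ?thesis by (simp add: basis_expansion)
qed

lemma has_vector_derivative_cong_at:
  assumes "\<forall>\<^sub>F s in at t. f s = g s" "f t = g t" "(g has_vector_derivative D) (at t)"
  shows "(f has_vector_derivative D) (at t)"
proof -
  have "(f has_vector_derivative D) (at t) \<longleftrightarrow> (g has_vector_derivative D) (at t)"
    using assms(1,2) by (intro has_vector_derivative_cong_ev) (auto simp: eventually_nhds_conv_at)
  then show ?thesis using assms(3) by simp
qed

text \<open>The parameter is real and differentiability is asked at 0 only. This is little enough
  for arcs in every tangent direction to be easy to produce, and enough to measure orders of growth
  in |s|.\<close>

definition arc_in ::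
  "(complex^'n) set \<Rightarrow> complex^'n \<Rightarrow> complex^'n \<Rightarrow> (real \<Rightarrow> complex^'n) \<Rightarrow> bool" where
  "arc_in S p w \<gamma> \<longleftrightarrow>
     \<gamma> 0 = p \<and> (\<gamma> has_vector_derivative w) (at 0) \<and> (\<forall>\<^sub>F s in at 0. \<gamma> s \<in> S)"

lemma arc_in_tendsto: "arc_in S p w \<gamma> \<Longrightarrow> (\<gamma> \<longlongrightarrow> p) (at 0)"
  unfolding arc_in_def using has_vector_derivative_continuous continuous_at by fastforce

lemma arc_in_eventually:
  assumes "arc_in S p w \<gamma>" "\<forall>\<^sub>F q in nhds p. q \<in> S \<longrightarrow> P q"
  shows "\<forall>\<^sub>F s in at 0. P (\<gamma> s)"
proof -
  have "\<forall>\<^sub>F s in at 0. \<gamma> s \<in> S \<longrightarrow> P (\<gamma> s)"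
    using eventually_compose_filterlim[OF assms(2) arc_in_tendsto[OF assms(1)]] .
  moreover have "\<forall>\<^sub>F s in at 0. \<gamma> s \<in> S" using assms(1) by (simp add: arc_in_def)
  ultimately show ?thesis by eventually_elim blast
qed

lemma arc_in_has_vector_derivative:
  assumes "arc_in S p w \<gamma>" "(\<phi> has_derivative \<phi>') (at p)"
  shows "((\<lambda>s. \<phi> (\<gamma> s)) has_vector_derivative \<phi>' w) (at 0)"
proof -
  have "(\<gamma> has_derivative (\<lambda>h. h *\<^sub>R w)) (at 0)" "\<gamma> 0 = p"
    using assms(1) by (auto simp: arc_in_def has_vector_derivative_def)
  from has_derivative_compose[OF this(1), of \<phi> \<phi>'] this(2) assms(2)
  have "((\<lambda>s. \<phi> (\<gamma> s)) has_derivative (\<lambda>h. \<phi>' (h *\<^sub>R w))) (at 0)" by simp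
  then show ?thesis
    using has_derivative_linear[OF assms(2)] by (simp add: has_vector_derivative_def linear_cmul)
qed

text \<open>
  A germ with differentials \<open>a\<^sub>j\<close> of its equations is straightened by
  \<open>q \<mapsto> (q - p) + \<Sum>\<^sub>j (F\<^sub>j q - a\<^sub>j (q - p)) r\<^sub>j\<close>, where \<open>a\<^sub>i (r\<^sub>j) = \<delta>\<^sub>i\<^sub>j\<close>: this map has the identity
  as its derivative at \<open>p\<close>, and \<open>a\<^sub>i\<close> composed with it is \<open>F\<^sub>i\<close>.
\<close>

lemma smooth_tangent_space:
  fixes S :: "(complex^'n) set"
  assumes smooth: "smooth_of_dim d S" and S0: "0 \<notin> S" and pS: "p \<in> S"
  shows "\<exists>T. vec.subspace T \<and> d + 1 \<le> vec.dim T \<and> (\<forall>w\<in>T. \<exists>\<gamma>. arc_in S p w \<gamma>) \<and>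
    (\<forall>w \<gamma>. arc_in S p w \<gamma> \<longrightarrow> w \<in> T)"
proof -
  obtain c F where cF: "CARD('n) = c + d + 1" "\<forall>i<c. \<exists>e. homogeneous_poly e (F i)"
    "zariski_near {x. x \<noteq> 0} p (\<lambda>x. x \<in> S \<longleftrightarrow> (\<forall>i<c. F i x = 0))"
    "\<And>a :: nat \<Rightarrow> complex.
       (\<forall>v. (\<Sum>i<c. a i * frechet_derivative (F i) (at p) v) = 0) \<Longrightarrow> \<forall>i<c. a i = 0"
    using smooth pS unfolding smooth_of_dim_def by blast
  have p0: "p \<noteq> 0" using S0 pS by blast
  have "\<forall>i. \<exists>D. i < c \<longrightarrow> continuous_on UNIV D \<and> (\<forall>x. (F i has_derivative linear_form (D x)) (at x))"
    using cF(2) homogeneous_poly_has_derivative by metis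
  then obtain D where D: "\<And>i. i < c \<Longrightarrow> continuous_on UNIV (D i)"
    "\<And>i x. i < c \<Longrightarrow> (F i has_derivative linear_form (D i x)) (at x)" by metis
  have fd: "frechet_derivative (F i) (at p) = linear_form (D i p)" if "i < c" for i
    using frechet_derivative_at[OF D(2)[OF that]] by simp
  have F0: "F i p = 0" if "i < c" for i
    using zariski_near_at[OF cF(3)] p0 pS that by simp
  have near: "\<forall>\<^sub>F x in nhds p. x \<in> S \<longleftrightarrow> (\<forall>i<c. F i x = 0)"
  proof -
    have "\<forall>\<^sub>F x in nhds p. x \<noteq> 0" using p0 by (rule t1_space_nhds)
    with zariski_near_eventually[OF cF(3)] show ?thesis by eventually_elim simp
  qed
  define T where "T = {w. \<forall>a\<in>(\<lambda>i. D i p) ` {..<c}. linear_form a w = 0}"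
  have "vec.subspace T" by (auto intro!: vec.subspaceI simp: T_def linear_form_bilinear)
  moreover have "d + 1 \<le> vec.dim T"
    using dim_annihilator_ge[of "(\<lambda>i. D i p) ` {..<c}"] card_image_le[of "{..<c}" "\<lambda>i. D i p"] cF(1)
    by (simp add: T_def)
  moreover have "w \<in> T" if arc: "arc_in S p w \<gamma>" for w \<gamma>
  proof -
    have "linear_form (D i p) w = 0" if i: "i < c" for i
    proof -
      have "((\<lambda>s. F i (\<gamma> s)) has_vector_derivative linear_form (D i p) w) (at 0)"
        using arc_in_has_vector_derivative[OF arc D(2)[OF i]] .
      moreover have "\<forall>\<^sub>F s in at 0. F i (\<gamma> s) = 0"
        by (rule arc_in_eventually[OF arc]) (use near in eventually_elim, use i in blast)
      then have "\<forall>\<^sub>F s in nhds 0. F i (\<gamma> s) = 0"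
        using F0[OF i] arc unfolding eventually_nhds_conv_at arc_in_def by simp
      then have "((\<lambda>s. F i (\<gamma> s)) has_vector_derivative 0) (at 0) \<longleftrightarrow>
          ((\<lambda>s. 0) has_vector_derivative (0::complex)) (at (0::real))"
        using F0[OF i] arc by (intro has_vector_derivative_cong_ev) (auto simp: arc_in_def)
      then have "((\<lambda>s. F i (\<gamma> s)) has_vector_derivative 0) (at 0)" by simp
      ultimately show ?thesis by (rule vector_derivative_unique_at)
    qed
    then show ?thesis by (simp add: T_def)
  qed
  moreover have "\<exists>\<gamma>. arc_in S p w \<gamma>" if w: "w \<in> T" for w
  proof -
    have "\<exists>r. \<forall>i<c. \<forall>j<c. linear_form (D i p) (r j) = (if i = j then 1 else 0)"
      by (rule exists_dual_family, rule cF(4)) (simp add: fd)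
    then obtain r where r: "\<And>i j. i < c \<Longrightarrow> j < c \<Longrightarrow>
        linear_form (D i p) (r j) = (if i = j then 1 else 0)" by blast
    define \<Psi> where "\<Psi> q = (q - p) + (\<Sum>j<c. (F j q - linear_form (D j p) (q - p)) *s r j)" for q
    define L where "L q v = v + (\<Sum>j<c. (linear_form (D j q) v - linear_form (D j p) v) *s r j)" for q v
    have der: "(\<Psi> has_derivative L q) (at q)" for q
    proof -
      have 1: "((\<lambda>q. q - p) has_derivative (\<lambda>v. v)) (at q)"
        by (auto intro!: derivative_eq_intros)
      have 2: "((\<lambda>q. (F j q - linear_form (D j p) (q - p)) *s r j) has_derivative
          (\<lambda>v. (linear_form (D j q) v - linear_form (D j p) v) *s r j)) (at q)" if "j < c" for j
      proof -
        have "((\<lambda>q. F j q - linear_form (D j p) (q - p)) has_derivative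
          (\<lambda>v. linear_form (D j q) v - linear_form (D j p) v)) (at q)"
          by (intro has_derivative_diff D(2) that
              has_derivative_compose[OF 1 linear_form_has_derivative])
        then show ?thesis
          by (rule bounded_linear.has_derivative[OF
              bounded_bilinear.bounded_linear_left[OF bounded_bilinear_vector_scalar_mult]])
      qed
      show ?thesis unfolding \<Psi>_def[abs_def] L_def[abs_def]
        by (intro has_derivative_add 1 has_derivative_sum 2) simp
    qed
    have blin: "bounded_linear (L q)" for q by (rule has_derivative_bounded_linear[OF der])
    define B where "B q = Blinfun (L q)" for q
    have B: "blinfun_apply (B q) = L q" for q
      unfolding B_def by (rule bounded_linear_Blinfun_apply[OF blin])
    have contB: "continuous_on UNIV B"
    proof (rule continuous_on_blinfun_componentwise)
      fix i :: "complex^'n"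
      show "continuous_on UNIV (\<lambda>q. blinfun_apply (B q) i)"
        unfolding B L_def
        by (intro continuous_on_add continuous_on_const continuous_on_sum continuous_on_diff
            bounded_bilinear.continuous_on[OF bounded_bilinear_vector_scalar_mult]
            bounded_bilinear.continuous_on[OF bounded_bilinear_linear_form] D(1)) simp
    qed
    have Lp: "L p = id" by (simp add: L_def[abs_def] id_def)
    have "id_blinfun o\<^sub>L B p = id_blinfun"
      by (rule blinfun_eqI) (simp add: B Lp)
    then obtain U V g g' where UV: "open U" "p \<in> U" "open V" "\<Psi> p \<in> V" "homeomorphism U V \<Psi> g"
      "\<And>y. y \<in> V \<Longrightarrow> (g has_derivative (g' y)) (at y)"
      "\<And>y. y \<in> V \<Longrightarrow> g' y = inv (blinfun_apply (B (g y)))"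
      using inverse_function_theorem[of UNIV \<Psi> B p id_blinfun] der B contB
      by (metis UNIV_I open_UNIV)
    have \<Psi>p: "\<Psi> p = 0" by (simp add: \<Psi>_def F0 linear_form_bilinear)
    have g0: "g 0 = p" using UV(2,5) \<Psi>p by (metis homeomorphism_apply1)
    have "g' 0 = id"
    proof -
      have "g' 0 = inv (blinfun_apply (B (g 0)))" using UV(4,7) \<Psi>p by metis
      then show ?thesis by (simp add: g0 B Lp)
    qed
    then have dg: "(g has_derivative id) (at 0)" using UV(4,6) \<Psi>p by metis
    \<comment> \<open>The line through 0 in direction \<open>w\<close>, pulled back by the
      straightening map. It stays in S because each equation is a form killing \<open>w\<close>,
      composed with that map.\<close>
    define \<gamma> where "\<gamma> s = g (s *\<^sub>R w)" for s :: real
    have v: "(\<gamma> has_vector_derivative w) (at 0)"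
    proof -
      have "((\<lambda>s. s *\<^sub>R w) has_derivative (\<lambda>s. s *\<^sub>R w)) (at (0::real))"
        by (rule bounded_linear_imp_has_derivative) (rule bounded_linear_scaleR_left)
      from has_derivative_compose[OF this, of g id] dg show ?thesis
        by (simp add: \<gamma>_def[abs_def] has_vector_derivative_def)
    qed
    have \<gamma>0: "\<gamma> 0 = p" by (simp add: \<gamma>_def g0)
    have "\<forall>\<^sub>F s in at 0. \<gamma> s \<in> S"
    proof -
      have "(\<gamma> \<longlongrightarrow> p) (at 0)"
        using has_vector_derivative_continuous[OF v] \<gamma>0 by (simp add: continuous_at)
      with near have near': "\<forall>\<^sub>F s in at 0. \<gamma> s \<in> S \<longleftrightarrow> (\<forall>i<c. F i (\<gamma> s) = 0)"
        by (rule eventually_compose_filterlim)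
      have "((\<lambda>s. s *\<^sub>R w) \<longlongrightarrow> 0 *\<^sub>R w) (at (0::real))" by (intro tendsto_intros)
      then have "\<forall>\<^sub>F s in at (0::real). s *\<^sub>R w \<in> V"
        using UV(3,4) \<Psi>p by (auto dest: topological_tendstoD)
      with near' show ?thesis
      proof eventually_elim
        case (elim s)
        have \<Psi>\<gamma>: "\<Psi> (\<gamma> s) = s *\<^sub>R w" unfolding \<gamma>_def using UV(5) elim by (metis homeomorphism_apply2)
        have "F i (\<gamma> s) = 0" if i: "i < c" for i
        proof -
          have "linear_form (D i p) (\<Psi> q) = F i q" for q
          proof -
            have "(\<Sum>j<c. (F j q - linear_form (D j p) (q - p)) * linear_form (D i p) (r j)) =
              (\<Sum>j<c. if j = i then F j q - linear_form (D j p) (q - p) else 0)"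
              by (rule sum.cong) (use r i in auto)
            moreover have "linear_form (D i p) (\<Psi> q) = linear_form (D i p) (q - p) +
               (\<Sum>j<c. (F j q - linear_form (D j p) (q - p)) * linear_form (D i p) (r j))"
              unfolding \<Psi>_def linear_form_commute[of "D i p"]
              by (simp add: linear_form_sum linear_form_bilinear left_diff_distrib)
            ultimately show ?thesis using i by simp
          qed
          from this[of "\<gamma> s"] show ?thesis
            using w i by (simp add: \<Psi>\<gamma> T_def linear_form_scaleR)
        qed
        then show ?case using elim by blast
      qed
    qed
    then show ?thesis using v \<gamma>0 unfolding arc_in_def by blast
  qed
  ultimately show ?thesis by blast
qed

text \<open>A single covector \<open>D\<close> serves all arcs through \<open>p\<close>: it is the
  differential of the germ, and its values on different tangent vectors can therefore be added and
  compared.\<close>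

lemma regular_at_arc_derivative:
  assumes "regular_at S m p f" "p \<in> S"
  shows "\<exists>D. \<forall>w \<gamma>. arc_in S p w \<gamma> \<longrightarrow> ((\<lambda>s. f (\<gamma> s)) has_vector_derivative linear_form D w) (at 0)"
proof -
  obtain \<phi> D where \<phi>: "(\<phi> has_derivative linear_form D) (at p)" "\<forall>\<^sub>F q in nhds p. q \<in> S \<longrightarrow> f q = \<phi> q"
    using regular_at_has_derivative[OF assms(1)] by blast
  have "((\<lambda>s. f (\<gamma> s)) has_vector_derivative linear_form D w) (at 0)" if arc: "arc_in S p w \<gamma>" for w \<gamma>
  proof -
    have "f p = \<phi> p" using \<phi>(2) assms(2) eventually_nhds_x_imp_x by blast
    moreover have "\<forall>\<^sub>F s in at 0. f (\<gamma> s) = \<phi> (\<gamma> s)" by (rule arc_in_eventually[OF arc \<phi>(2)])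
    ultimately have "\<forall>\<^sub>F s in nhds 0. s \<in> UNIV \<longrightarrow> f (\<gamma> s) = \<phi> (\<gamma> s)" "f (\<gamma> 0) = \<phi> (\<gamma> 0)"
      using arc by (auto simp: eventually_nhds_conv_at arc_in_def)
    then show ?thesis
      using arc_in_has_vector_derivative[OF arc \<phi>(1)] by (simp add: has_vector_derivative_cong_ev)
  qed
  then show ?thesis by blast
qed

lemma regular_at_arc_tendsto:
  assumes "regular_at S m p f" "p \<in> S" "arc_in S p w \<gamma>"
  shows "((\<lambda>s. f (\<gamma> s)) \<longlongrightarrow> f p) (at 0)"
proof -
  obtain D where "((\<lambda>s. f (\<gamma> s)) has_vector_derivative linear_form D w) (at 0)"
    using regular_at_arc_derivative[OF assms(1,2)] assms(3) by blast
  from has_vector_derivative_continuous[OF this] show ?thesis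
    using assms(3) by (simp add: continuous_at arc_in_def)
qed

section \<open>Orders of growth along arcs\<close>

lemma has_vector_derivative_bounds:
  fixes f :: "real \<Rightarrow> 'a::real_normed_vector"
  assumes "(f has_vector_derivative D) (at 0)" "f 0 = 0"
  shows "e > 0 \<Longrightarrow> \<forall>\<^sub>F s in at 0. norm (f s) \<le> (norm D + e) * \<bar>s\<bar>"
    and "e > 0 \<Longrightarrow> \<forall>\<^sub>F s in at 0. (norm D - e) * \<bar>s\<bar> \<le> norm (f s)"
proof -
  have lim: "((\<lambda>h. norm (f h - h *\<^sub>R D) / \<bar>h\<bar>) \<longlongrightarrow> 0) (at 0)"
    using assms by (simp add: has_vector_derivative_def has_derivative_at)
  have ev: "\<forall>\<^sub>F h in at 0. norm (f h - h *\<^sub>R D) \<le> e * \<bar>h\<bar>" if "e > 0"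
  proof -
    have "\<forall>\<^sub>F h in at 0. norm (f h - h *\<^sub>R D) / \<bar>h\<bar> < e"
      using order_tendstoD(2)[OF lim that] .
    moreover have "\<forall>\<^sub>F h in at (0::real). h \<noteq> 0" by (simp add: eventually_at_filter)
    ultimately show ?thesis by eventually_elim (simp add: field_simps)
  qed
  show "\<forall>\<^sub>F s in at 0. norm (f s) \<le> (norm D + e) * \<bar>s\<bar>" if "e > 0"
    using ev[OF that]
  proof eventually_elim
    case (elim s)
    then show ?case using norm_triangle_sub[of "f s" "s *\<^sub>R D"] by (simp add: algebra_simps)
  qed
  show "\<forall>\<^sub>F s in at 0. (norm D - e) * \<bar>s\<bar> \<le> norm (f s)" if "e > 0"
    using ev[OF that]
  proof eventually_elim
    case (elim s)
    then show ?case using norm_triangle_sub[of "s *\<^sub>R D" "f s"]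
      by (simp add: algebra_simps norm_minus_commute)
  qed
qed

lemma regular_at_arc_upper:
  assumes "regular_at S m p f" "p \<in> S" "f p = 0" "arc_in S p w \<gamma>"
  shows "\<exists>C>0. \<forall>\<^sub>F s in at 0. cmod (f (\<gamma> s)) \<le> C * \<bar>s\<bar>"
proof -
  obtain D where D: "((\<lambda>s. f (\<gamma> s)) has_vector_derivative linear_form D w) (at 0)"
    using regular_at_arc_derivative[OF assms(1,2)] assms(4) by blast
  have "f (\<gamma> 0) = 0" using assms by (simp add: arc_in_def)
  from has_vector_derivative_bounds(1)[OF D this, of 1] show ?thesis
    by (intro exI[of _ "cmod (linear_form D w) + 1"]) (auto intro: add_nonneg_pos)
qed

text \<open>Every factor vanishing at \<open>p\<close> is O(|s|) along the arc, and membership in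
  the j-th power supplies j such factors in each summand.\<close>

lemma max_power_section_arc_upper:
  assumes "max_power_section S p j f" "p \<in> S" "arc_in S p w \<gamma>"
  shows "\<exists>C. \<forall>\<^sub>F s in at 0. cmod (f (\<gamma> s)) \<le> C * \<bar>s\<bar> ^ j"
  using assms(1)
proof (induction j arbitrary: f)
  case 0
  then have "((\<lambda>s. f (\<gamma> s)) \<longlongrightarrow> f p) (at 0)" using regular_at_arc_tendsto assms by simp
  then have "\<forall>\<^sub>F s in at 0. cmod (f (\<gamma> s)) < cmod (f p) + 1"
    by (intro order_tendstoD(2)[OF tendsto_norm]) auto
  then show ?case by (intro exI[of _ "cmod (f p) + 1"]) (auto elim: eventually_mono)
next
  case (Suc j)
  then obtain n :: nat and g r where gr: "\<forall>i<n. regular_at S 0 p (g i) \<and> g i p = 0 \<and> max_power_section S p j (r i)"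
    "zariski_near S p (\<lambda>q. f q = (\<Sum>i<n. g i q * r i q))" by auto
  have "\<exists>C. \<forall>\<^sub>F s in at 0. cmod (g i (\<gamma> s) * r i (\<gamma> s)) \<le> C * \<bar>s\<bar> ^ Suc j" if i: "i \<in> {..<n}" for i
  proof -
    have gi: "regular_at S 0 p (g i)" "g i p = 0" and ri: "max_power_section S p j (r i)"
      using gr(1) i by auto
    obtain A where A: "A > 0" "\<forall>\<^sub>F s in at 0. cmod (g i (\<gamma> s)) \<le> A * \<bar>s\<bar>"
      using regular_at_arc_upper[OF gi(1) assms(2) gi(2) assms(3)] by (elim exE conjE)
    obtain B where B: "\<forall>\<^sub>F s in at 0. cmod (r i (\<gamma> s)) \<le> B * \<bar>s\<bar> ^ j"
      using Suc.IH[OF ri] by (elim exE)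
    from A(2) B have "\<forall>\<^sub>F s in at 0. cmod (g i (\<gamma> s) * r i (\<gamma> s)) \<le> (A * B) * \<bar>s\<bar> ^ Suc j"
    proof eventually_elim
      case (elim s)
      then have "cmod (g i (\<gamma> s)) * cmod (r i (\<gamma> s)) \<le> (A * \<bar>s\<bar>) * (B * \<bar>s\<bar> ^ j)"
        using A(1) by (intro mult_mono) auto
      then show ?case by (simp add: norm_mult algebra_simps)
    qed
    then show ?thesis by (rule exI)
  qed
  then have "\<forall>i\<in>{..<n}. \<exists>C. \<forall>\<^sub>F s in at 0. cmod (g i (\<gamma> s) * r i (\<gamma> s)) \<le> C * \<bar>s\<bar> ^ Suc j"
    by (rule ballI)
  from bchoice[OF this] obtain C where C: "\<forall>i\<in>{..<n}. \<forall>\<^sub>F s in at 0.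
      cmod (g i (\<gamma> s) * r i (\<gamma> s)) \<le> C i * \<bar>s\<bar> ^ Suc j" by (elim exE)
  have "\<forall>\<^sub>F s in at 0. \<forall>i\<in>{..<n}. cmod (g i (\<gamma> s) * r i (\<gamma> s)) \<le> C i * \<bar>s\<bar> ^ Suc j"
    using C by (intro eventually_ball_finite) simp_all
  moreover have "\<forall>\<^sub>F s in at 0. f (\<gamma> s) = (\<Sum>i<n. g i (\<gamma> s) * r i (\<gamma> s))"
    by (rule arc_in_eventually[OF assms(3) zariski_near_eventually[OF gr(2)]])
  ultimately have "\<forall>\<^sub>F s in at 0. cmod (f (\<gamma> s)) \<le> (\<Sum>i<n. C i) * \<bar>s\<bar> ^ Suc j"
  proof eventually_elim
    case (elim s)
    have "cmod (f (\<gamma> s)) \<le> (\<Sum>i<n. cmod (g i (\<gamma> s) * r i (\<gamma> s)))"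
      unfolding elim(2) by (rule norm_sum)
    also have "\<dots> \<le> (\<Sum>i<n. C i * \<bar>s\<bar> ^ Suc j)"
      using elim(1) by (intro sum_mono) simp
    finally show ?case by (simp add: sum_distrib_right)
  qed
  then show ?case by (rule exI)
qed

subsection \<open>A line on a surface\<close>

text \<open>One function \<open>h\<close> is a local equation at all points of the line. This is how
  triviality of O(D) along D enters: quotients by powers of \<open>h\<close> taken at different
  points agree without transition functions. The plane \<open>W\<close> is the cone over the line
  together with its vertex.\<close>

locale line_on_surface =
  fixes S W :: "(complex^'n) set" and h :: "complex^'n \<Rightarrow> complex"
  assumes zero_notin: "0 \<notin> S" and smooth: "smooth_of_dim 2 S"
    and subspace: "vec.subspace W" and dim: "vec.dim W = 2" and line_subset: "W - {0} \<subseteq> S"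
    and equation: "\<And>p. p \<in> W - {0} \<Longrightarrow> local_equation S (W - {0}) p h"
begin

lemma arc_on_line:
  assumes "p \<in> W - {0}" "w \<in> W"
  shows "arc_in S p w (\<lambda>s. p + s *\<^sub>R w)"
proof -
  have "((\<lambda>s. p + s *\<^sub>R w) has_vector_derivative w) (at 0)"
    by (auto intro!: derivative_eq_intros)
  moreover have "p + s *\<^sub>R w \<in> W" for s
    using assms subspace
    by (simp add: scaleR_vec_conv_vector_scalar_mult vec.subspace_add vec.subspace_scale)
  moreover have "\<forall>\<^sub>F s in at (0::real). p + s *\<^sub>R w \<noteq> 0"
  proof (rule tendsto_imp_eventually_ne)
    show "((\<lambda>s. p + s *\<^sub>R w) \<longlongrightarrow> p + 0 *\<^sub>R w) (at (0::real))" by (intro tendsto_intros)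
    show "p + 0 *\<^sub>R w \<noteq> 0" using assms by simp
  qed
  ultimately show ?thesis
    using line_subset unfolding arc_in_def by (auto elim!: eventually_mono)
qed

text \<open>The cone over the surface has a tangent space of dimension at least 3; it contains the
  plane \<open>W\<close>, whose vectors are velocities of straight arcs, and dimension makes the
  inclusion strict.\<close>

lemma tangent_space:
  assumes "p \<in> W - {0}"
  shows "\<exists>T. vec.subspace T \<and> W \<subset> T \<and> (\<forall>w\<in>T. \<exists>\<gamma>. arc_in S p w \<gamma>)"
proof -
  obtain T where T: "vec.subspace T" "2 + 1 \<le> vec.dim T" "\<forall>w\<in>T. \<exists>\<gamma>. arc_in S p w \<gamma>"
    "\<forall>w \<gamma>. arc_in S p w \<gamma> \<longrightarrow> w \<in> T"
    using smooth_tangent_space[OF smooth zero_notin] assms line_subset by blast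
  have "W \<subseteq> T" using T(4) arc_on_line[OF assms] by blast
  moreover have "W \<noteq> T" using T(2) dim by auto
  ultimately show ?thesis using T by blast
qed

lemma transversal_arc:
  assumes "p \<in> W - {0}"
  shows "\<exists>w \<gamma>. w \<notin> W \<and> arc_in S p w \<gamma>"
  using tangent_space[OF assms] by blast

text \<open>Choose a form \<open>l\<close> that vanishes on \<open>W\<close> and is 1 at
  \<open>w\<close>. Dehomogenized by \<open>m\<close>, it lies in the ideal of the line and is a
  multiple of \<open>h'\<close>. Since \<open>l\<close> grows like |s| along the arc and the
  cofactor is bounded, \<open>h'\<close> cannot vanish to higher order.\<close>

lemma equation_lower:
  assumes p: "p \<in> W - {0}" and h': "local_equation S (W - {0}) p h'"
    and arc: "arc_in S p w \<gamma>" and w: "w \<notin> W"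
  shows "\<exists>c>0. \<forall>\<^sub>F s in at 0. c * \<bar>s\<bar> \<le> cmod (h' (\<gamma> s))"
proof -
  obtain l where l: "\<forall>y\<in>W. linear_form l y = 0" "linear_form l w = 1"
    using exists_linear_form_vanishing_on_subspace[OF subspace w] by blast
  obtain m where m: "linear_form m p = 1" using linear_form_separates p by blast
  let ?g = "\<lambda>q. linear_form l q / linear_form m q"
  have "regular_at S 0 p ?g"
    by (rule regular_at_divide_linear_form[OF regular_at_linear_form]) (simp add: m)
  moreover have "zariski_near S p (\<lambda>q. q \<in> W - {0} \<longrightarrow> ?g q = 0)"
    using l by (intro zariski_near_all) auto
  ultimately obtain e where e: "regular_at S 0 p e" "zariski_near S p (\<lambda>q. ?g q = h' q * e q)"
    using h' unfolding local_equation_def by blast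
  have pS: "p \<in> S" using p line_subset by blast
  have m1: "\<forall>\<^sub>F s in at 0. cmod (linear_form m (\<gamma> s)) < 2"
    using regular_at_arc_tendsto[OF regular_at_linear_form pS arc, of m] m
    by (intro order_tendstoD(2)[OF tendsto_norm]) auto
  have m2: "\<forall>\<^sub>F s in at 0. linear_form m (\<gamma> s) \<noteq> 0"
    using regular_at_arc_tendsto[OF regular_at_linear_form pS arc, of m] m
    by (intro tendsto_imp_eventually_ne) auto
  have e1: "\<forall>\<^sub>F s in at 0. cmod (e (\<gamma> s)) < cmod (e p) + 1"
    using regular_at_arc_tendsto[OF e(1) pS arc]
    by (intro order_tendstoD(2)[OF tendsto_norm]) auto
  have "((\<lambda>s. linear_form l (\<gamma> s)) has_vector_derivative linear_form l w) (at 0)"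
    by (rule arc_in_has_vector_derivative[OF arc linear_form_has_derivative])
  from has_vector_derivative_bounds(2)[OF this, of "1/2"] l arc p
  have l1: "\<forall>\<^sub>F s in at 0. \<bar>s\<bar> \<le> 2 * cmod (linear_form l (\<gamma> s))" by (simp add: arc_in_def mult.commute)
  \<comment> \<open>One factor 2 comes from the lower bound for \<open>l\<close>, the other from the
    bound 2 for \<open>m\<close>; the bracket bounds the cofactor \<open>e\<close>.\<close>
  let ?M = "4 * (cmod (e p) + 1)"
  have M: "?M > 0" by (simp add: add_nonneg_pos)
  have "\<forall>\<^sub>F s in at 0. 1 / ?M * \<bar>s\<bar> \<le> cmod (h' (\<gamma> s))"
    using m1 m2 e1 l1 arc_in_eventually[OF arc zariski_near_eventually[OF e(2)]]
  proof eventually_elim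
    case (elim s)
    have "linear_form l (\<gamma> s) = h' (\<gamma> s) * e (\<gamma> s) * linear_form m (\<gamma> s)"
      using elim by (simp add: field_simps)
    then have "cmod (linear_form l (\<gamma> s)) = cmod (h' (\<gamma> s)) * (cmod (e (\<gamma> s)) * cmod (linear_form m (\<gamma> s)))"
      by (simp add: norm_mult)
    also have "\<dots> \<le> cmod (h' (\<gamma> s)) * ((cmod (e p) + 1) * 2)"
      using elim by (intro mult_left_mono mult_mono) auto
    finally have "\<bar>s\<bar> \<le> cmod (h' (\<gamma> s)) * ?M" using elim by linarith
    then show ?case using M by (simp add: field_simps)
  qed
  then show ?thesis using M by (meson zero_less_divide_1_iff)
qed

section \<open>Cancelling and dividing by the equation of the line\<close>

lemma equation_nonzero:
  assumes "p \<in> W - {0}" "local_equation S (W - {0}) p h'" "arc_in S p w \<gamma>" "w \<notin> W"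
  shows "\<forall>\<^sub>F s in at 0. h' (\<gamma> s) \<noteq> 0"
proof -
  obtain c where "c > 0" "\<forall>\<^sub>F s in at 0. c * \<bar>s\<bar> \<le> cmod (h' (\<gamma> s))"
    using equation_lower[OF assms] by blast
  note this(2)
  moreover have "\<forall>\<^sub>F s in at (0::real). s \<noteq> 0" by (simp add: eventually_at_filter)
  ultimately show ?thesis
  proof eventually_elim
    case (elim s)
    then have "c * \<bar>s\<bar> > 0" using \<open>c > 0\<close> by simp
    then show ?case using elim by auto
  qed
qed

text \<open>Along a transversal arc \<open>h'\<close> is nonzero off s = 0, so both germs agree
  there, and continuity carries the equality to \<open>p\<close>. Only the values at
  \<open>p\<close> are compared.\<close>

lemma regular_at_cancel:
  assumes p: "p \<in> W - {0}" and h': "local_equation S (W - {0}) p h'"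
    and g: "regular_at S m p g" "regular_at S m p g'"
    and eq: "zariski_near S p (\<lambda>q. h' q ^ t * g q = h' q ^ t * g' q)"
  shows "g p = g' p"
proof -
  obtain w \<gamma> where w: "w \<notin> W" "arc_in S p w \<gamma>" using transversal_arc[OF p] by blast
  have pS: "p \<in> S" using p line_subset by blast
  have "\<forall>\<^sub>F s in at 0. g (\<gamma> s) = g' (\<gamma> s)"
    using equation_nonzero[OF p h' w(2,1)] arc_in_eventually[OF w(2) zariski_near_eventually[OF eq]]
    by eventually_elim simp
  then have "((\<lambda>s. g (\<gamma> s)) \<longlongrightarrow> g' p) (at 0)"
    using regular_at_arc_tendsto[OF g(2) pS w(2)] by (simp add: tendsto_cong)
  then show ?thesis
    using regular_at_arc_tendsto[OF g(1) pS w(2)] tendsto_unique trivial_limit_at by blast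
qed

text \<open>Two equations divide each other, with cofactors \<open>e\<close> and \<open>e'\<close>.
  Cancelling \<open>h\<close> from \<open>h * (e * e') = h\<close> gives
  \<open>e p * e' p = 1\<close>.\<close>

lemma local_equation_unit:
  assumes p: "p \<in> W - {0}" and h': "local_equation S (W - {0}) p h'"
  shows "\<exists>e. regular_at S 0 p e \<and> zariski_near S p (\<lambda>q. h' q = h q * e q) \<and> e p \<noteq> 0"
proof -
  obtain e where e: "regular_at S 0 p e" "zariski_near S p (\<lambda>q. h' q = h q * e q)"
    using local_equation_associate[OF equation[OF p] h'] by blast
  obtain e' where e': "regular_at S 0 p e'" "zariski_near S p (\<lambda>q. h q = h' q * e' q)"
    using local_equation_associate[OF h' equation[OF p]] by blast
  have "zariski_near S p (\<lambda>q. h q ^ 1 * (e q * e' q) = h q ^ 1 * 1)"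
    using e(2) e'(2) by (rule zariski_near_mono2) (metis mult.assoc mult.right_neutral power_one_right)
  from regular_at_cancel[OF p equation[OF p] _ _ this]
  have "e p * e' p = 1" using regular_at_mult[OF e(1) e'(1)] regular_at_const[of S p 1] by simp
  then show ?thesis using e by auto
qed

text \<open>The germ \<open>g\<close> is the section \<open>a\<close> regarded as a local section of
  L(-tD), in the trivialization given by the t-th power of \<open>h\<close>.\<close>

definition quot :: "nat \<Rightarrow> complex^'n \<Rightarrow> complex^'n \<Rightarrow> (complex^'n \<Rightarrow> complex) \<Rightarrow> bool" where
  "quot t a p g \<longleftrightarrow>
     regular_at S 1 p g \<and> zariski_near S p (\<lambda>q. linear_form a q = h q ^ t * g q)"

lemma quot_unique:
  assumes "p \<in> W - {0}" "quot t a p g" "quot t a p g'"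
  shows "g p = g' p"
proof (rule regular_at_cancel[OF assms(1) equation[OF assms(1)]])
  show "regular_at S 1 p g" "regular_at S 1 p g'" using assms unfolding quot_def by auto
  show "zariski_near S p (\<lambda>q. h q ^ t * g q = h q ^ t * g' q)"
    by (rule zariski_near_mono2[of S p "\<lambda>q. linear_form a q = h q ^ t * g q"
          "\<lambda>q. linear_form a q = h q ^ t * g' q"])
      (use assms in \<open>auto simp: quot_def\<close>)
qed

lemma quot_open: "quot t a p g \<Longrightarrow> zariski_near S p (\<lambda>q. quot t a q g)"
  unfolding quot_def by (intro zariski_near_conj regular_at_open zariski_near_open) auto

lemma quot_scale: "quot t a p g \<Longrightarrow> c \<noteq> 0 \<Longrightarrow> quot t a (c *s p) g"
  unfolding quot_def by (intro conjI regular_at_scale zariski_near_scale) auto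

lemma quot_linear_combination:
  assumes "quot t a p g" "quot t a' p g'"
  shows "quot t (c *s a + c' *s a') p (\<lambda>q. c * g q + c' * g' q)"
  unfolding quot_def
proof (intro conjI regular_at_add regular_at_cmult)
  show "regular_at S 1 p g" "regular_at S 1 p g'" using assms unfolding quot_def by auto
  show "zariski_near S p (\<lambda>q. linear_form (c *s a + c' *s a') q = h q ^ t * (c * g q + c' * g' q))"
    by (rule zariski_near_mono2[of S p "\<lambda>q. linear_form a q = h q ^ t * g q"
          "\<lambda>q. linear_form a' q = h q ^ t * g' q"])
      (use assms in \<open>auto simp: quot_def linear_form_bilinear algebra_simps\<close>)
qed

lemma quot_sum:
  assumes "\<And>i. i \<in> I \<Longrightarrow> quot t (a i) p (g i)"
  shows "quot t (\<Sum>i\<in>I. c i *s a i) p (\<lambda>q. \<Sum>i\<in>I. c i * g i q)"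
  using assms
proof (induction I rule: infinite_finite_induct)
  case (insert i I)
  then show ?case using quot_linear_combination[of t "a i" p "g i" _ _ "c i" 1] by simp
qed (use regular_at_linear_form[of _ _ 0] in
    \<open>auto simp: quot_def linear_form_bilinear(7)[abs_def] intro: zariski_near_all\<close>)

text \<open>
  Dividing out \<open>h\<^sup>t\<close> and restricting to the line gives a regular section of \<open>O(1)\<close> over the
  projective line.  In an affine coordinate it is an entire function of at most linear growth.
\<close>

lemma quot_linear_form:
  assumes "\<And>p. p \<in> W - {0} \<Longrightarrow> \<exists>g. quot t a p g"
  shows "\<exists>b. \<forall>p\<in>W - {0}. \<forall>g. quot t a p g \<longrightarrow> g p = linear_form b p"
proof -
  obtain G where G: "\<And>p. p \<in> W - {0} \<Longrightarrow> quot t a p (G p)" using assms by metis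
  \<comment> \<open>The germ \<open>G p\<close> depends on choices; by \<open>quot_unique\<close>
    its value at the base point does not, and this diagonal value is the function on the
    line.\<close>
  define val where "val p = G p p" for p
  have val: "g p = val p" if "p \<in> W - {0}" "quot t a p g" for p g
    unfolding val_def using quot_unique[OF that(1) that(2) G[OF that(1)]] .
  have val_near: "\<exists>\<phi> D. (\<phi> has_derivative linear_form D) (at p) \<and>
      (\<forall>\<^sub>F q in nhds p. q \<in> W - {0} \<longrightarrow> val q = \<phi> q)" if p: "p \<in> W - {0}" for p
  proof -
    obtain \<phi> D where \<phi>: "(\<phi> has_derivative linear_form D) (at p)"
      "\<forall>\<^sub>F q in nhds p. q \<in> S \<longrightarrow> G p q = \<phi> q"
      using regular_at_has_derivative G[OF p] unfolding quot_def by blast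
    from \<phi>(2) zariski_near_eventually[OF quot_open[OF G[OF p]]]
    have "\<forall>\<^sub>F q in nhds p. q \<in> W - {0} \<longrightarrow> val q = \<phi> q"
      by eventually_elim (use line_subset val in force)
    then show ?thesis using \<phi>(1) by blast
  qed
  have val_scale: "val (c *s p) = c * val p" if "p \<in> W - {0}" "c \<noteq> 0" for c p
  proof -
    have cp: "c *s p \<in> W - {0}" using that subspace by (simp add: vec.subspace_scale)
    have "val (c *s p) = G p (c *s p)" using val[OF cp quot_scale[OF G[OF that(1)] that(2)]] by simp
    also have "\<dots> = c ^ 1 * G p p"
      by (rule regular_at_homogeneous[where X = S])
        (use G[OF that(1)] cp that line_subset in \<open>auto simp: quot_def\<close>)
    finally show ?thesis by (simp add: val_def)
  qed
  obtain p0 where p0: "p0 \<in> W" "p0 \<noteq> 0"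
  proof -
    have "\<not> W \<subseteq> {0}"
    proof
      assume "W \<subseteq> {0}"
      then have "vec.dim W \<le> vec.dim {0 :: complex^'n}" by (intro vec.dim_subset)
      then show False using dim by simp
    qed
    then show ?thesis using that by blast
  qed
  obtain p1 where p1: "p1 \<in> W" "\<And>\<alpha> \<beta>. \<alpha> *s p0 + \<beta> *s p1 = 0 \<Longrightarrow> \<alpha> = 0 \<and> \<beta> = 0"
    "W = {\<alpha> *s p0 + \<beta> *s p1 |\<alpha> \<beta>. True}"
    using two_dimensional_subspace[OF subspace dim p0] by blast
  have inW: "\<alpha> *s p0 + \<beta> *s p1 \<in> W - {0}" if "\<alpha> \<noteq> 0 \<or> \<beta> \<noteq> 0" for \<alpha> \<beta>
    using p1(2)[of \<alpha> \<beta>] that by (subst p1(3)) blast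
  have p1W: "p1 \<in> W - {0}" using inW[of 0 1] by simp
  have line_tendsto: "((\<lambda>\<epsilon>. u + \<epsilon> *s v) \<longlongrightarrow> u + z *s v) (at z)" for u v :: "complex^'n" and z :: complex
    by (intro tendsto_intros bounded_bilinear.tendsto[OF bounded_bilinear_vector_scalar_mult])
  obtain \<phi> D where \<phi>: "(\<phi> has_derivative linear_form D) (at p1)"
    "\<forall>\<^sub>F q in nhds p1. q \<in> W - {0} \<longrightarrow> val q = \<phi> q"
    using val_near[OF p1W] by blast
  have \<phi>1: "\<phi> p1 = val p1" using \<phi>(2) p1W eventually_nhds_x_imp_x by force
  have at_p1: "((\<lambda>\<epsilon>. val (p1 + \<epsilon> *s p0)) \<longlongrightarrow> val p1) (at 0)"
  proof -
    have lim: "((\<lambda>\<epsilon>. p1 + \<epsilon> *s p0) \<longlongrightarrow> p1) (at (0::complex))" using line_tendsto[of p1 p0 0] by simp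
    have "isCont \<phi> p1" using \<phi>(1) has_derivative_continuous by blast
    then have "((\<lambda>\<epsilon>. \<phi> (p1 + \<epsilon> *s p0)) \<longlongrightarrow> val p1) (at 0)"
      using isCont_tendsto_compose[OF _ lim] \<phi>1 by metis
    moreover have "\<forall>\<^sub>F \<epsilon> in at 0. \<phi> (p1 + \<epsilon> *s p0) = val (p1 + \<epsilon> *s p0)"
      using eventually_compose_filterlim[OF \<phi>(2) lim]
      by eventually_elim (use inW[of _ 1] in \<open>simp add: add.commute\<close>)
    ultimately show ?thesis by (simp add: tendsto_cong)
  qed
  define H where "H s = val (p0 + s *s p1)" for s
  have "H field_differentiable at s" for s
  proof -
    have ps: "p0 + s *s p1 \<in> W - {0}" using inW[of 1 s] by simp
    obtain \<phi> D where \<phi>: "(\<phi> has_derivative linear_form D) (at (p0 + s *s p1))"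
      "\<forall>\<^sub>F q in nhds (p0 + s *s p1). q \<in> W - {0} \<longrightarrow> val q = \<phi> q"
      using val_near[OF ps] by blast
    have "((\<lambda>s. s *s p1) has_derivative (\<lambda>s. s *s p1)) (at s)"
      by (rule bounded_linear_imp_has_derivative)
        (rule bounded_bilinear.bounded_linear_left[OF bounded_bilinear_vector_scalar_mult])
    then have "((\<lambda>s. p0 + s *s p1) has_derivative (\<lambda>s. s *s p1)) (at s)"
      by (auto intro: has_derivative_eq_rhs[OF has_derivative_add[OF has_derivative_const]])
    from has_derivative_compose[OF this \<phi>(1)]
    have "((\<lambda>s. \<phi> (p0 + s *s p1)) has_field_derivative linear_form D p1) (at s)"
      by (simp add: has_field_derivative_def linear_form_bilinear mult_commute_abs)
    moreover have "\<forall>\<^sub>F z in nhds s. \<phi> (p0 + z *s p1) = H z"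
    proof -
      have "((\<lambda>z. p0 + z *s p1) \<longlongrightarrow> p0 + s *s p1) (nhds s)"
        using line_tendsto[of p0 p1 s] tendsto_at_iff_tendsto_nhds[of "\<lambda>z. p0 + z *s p1" s] by simp
      from eventually_compose_filterlim[OF \<phi>(2) this]
      show ?thesis by eventually_elim (use inW[of 1] in \<open>simp add: H_def\<close>)
    qed
    ultimately have "(H has_field_derivative linear_form D p1) (at s)"
      by (simp add: DERIV_cong_ev)
    then show ?thesis unfolding field_differentiable_def by blast
  qed
  then have holo: "H holomorphic_on UNIV" by (simp add: holomorphic_on_def)
  \<comment> \<open>Homogeneity of degree 1 is the change of chart: the parameter \<open>1/s\<close>
    is a coordinate around the point \<open>p1\<close>, which the chart \<open>p0 + s *s p1\<close>
    misses.\<close>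
  have H_val: "H s = s * val (p1 + (1/s) *s p0)" if "s \<noteq> 0" for s
  proof -
    have eq: "p0 + s *s p1 = s *s (p1 + (1/s) *s p0)"
      using that by (simp add: vec_eq_iff algebra_simps)
    have "p1 + (1/s) *s p0 \<in> W - {0}" using inW[of "1/s" 1] by (simp add: add.commute)
    from val_scale[OF this that] show ?thesis unfolding H_def eq .
  qed
  have "\<forall>\<^sub>F \<epsilon> in at 0. cmod (val (p1 + \<epsilon> *s p0)) < cmod (val p1) + 1"
    by (rule order_tendstoD(2)[OF tendsto_norm[OF at_p1]]) simp
  then obtain \<delta> where \<delta>: "\<delta> > 0" "\<And>\<epsilon>. \<epsilon> \<noteq> 0 \<Longrightarrow> cmod \<epsilon> < \<delta> \<Longrightarrow> cmod (val (p1 + \<epsilon> *s p0)) < cmod (val p1) + 1"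
    unfolding eventually_at by auto
  \<comment> \<open>For |s| at least \<open>2 / \<delta>\<close> the point lies in the neighbourhood
    of \<open>p1\<close> on which \<open>val\<close> is bounded. The exponent 1 is the degree of
    O(1), and Liouville then leaves a polynomial of degree at most 1.\<close>
  have growth: "cmod (H s) \<le> (cmod (val p1) + 1) * cmod s ^ 1" if s: "2 / \<delta> \<le> cmod s" for s
  proof -
    have "2 / \<delta> > 0" using \<delta>(1) by simp
    then have s0: "s \<noteq> 0" using s by auto
    have "cmod (1 / s) < \<delta>" using s s0 \<delta>(1) by (simp add: norm_divide field_simps)
    then have "cmod (val (p1 + (1/s) *s p0)) \<le> cmod (val p1) + 1" using \<delta>(2)[of "1/s"] s0 by simp
    then show ?thesis unfolding H_val[OF s0] norm_mult
      by (simp add: mult.commute mult_left_mono)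
  qed
  define c0 c1 where "c0 = H 0" and "c1 = deriv H 0"
  have H: "H s = c0 + c1 * s" for s
    using Liouville_polynomial[OF holo growth, where \<xi> = s] by (simp add: c0_def c1_def)
  \<comment> \<open>The value at the missing point is the leading coefficient, the limit of
    \<open>\<epsilon> * H (1 / \<epsilon>)\<close> as \<epsilon> tends to 0.\<close>
  have v1: "val p1 = c1"
  proof -
    have "((\<lambda>\<epsilon>. \<epsilon> * c0 + c1) \<longlongrightarrow> 0 * c0 + c1) (at 0)" by (intro tendsto_intros)
    moreover have "\<forall>\<^sub>F \<epsilon> in at 0. \<epsilon> * c0 + c1 = val (p1 + \<epsilon> *s p0)"
    proof -
      have "\<forall>\<^sub>F \<epsilon> in at (0::complex). \<epsilon> \<noteq> 0" by (simp add: eventually_at_filter)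
      then show ?thesis
      proof eventually_elim
        case (elim \<epsilon>)
        then show ?case using H_val[of "1 / \<epsilon>"] by (simp add: H field_simps)
      qed
    qed
    ultimately have "((\<lambda>\<epsilon>. val (p1 + \<epsilon> *s p0)) \<longlongrightarrow> c1) (at 0)"
      by (simp add: tendsto_cong)
    then show ?thesis using at_p1 tendsto_unique trivial_limit_at by blast
  qed
  obtain l0 where l0: "linear_form l0 p0 = 1" "linear_form l0 p1 = 0"
  proof -
    have "p0 \<notin> vec.span {p1}"
    proof
      assume "p0 \<in> vec.span {p1}"
      then obtain k where "p0 = k *s p1" by (auto simp: vec.span_singleton)
      then have "1 *s p0 + (- k) *s p1 = 0" by simp
      from p1(2)[OF this] show False by simp
    qed
    from exists_linear_form_vanishing_on_subspace[OF vec.subspace_span this]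
    show ?thesis using that vec.span_base by blast
  qed
  obtain l1 where l1: "linear_form l1 p1 = 1" "linear_form l1 p0 = 0"
  proof -
    have "p1 \<notin> vec.span {p0}"
    proof
      assume "p1 \<in> vec.span {p0}"
      then obtain k where "p1 = k *s p0" by (auto simp: vec.span_singleton)
      then have "(- k) *s p0 + 1 *s p1 = 0" by simp
      from p1(2)[OF this] show False by simp
    qed
    from exists_linear_form_vanishing_on_subspace[OF vec.subspace_span this]
    show ?thesis using that vec.span_base by blast
  qed
  let ?b = "c0 *s l0 + c1 *s l1"
  have "val p = linear_form ?b p" if p: "p \<in> W - {0}" for p
  proof -
    obtain \<alpha> \<beta> where ab: "p = \<alpha> *s p0 + \<beta> *s p1" using p by (subst (asm) p1(3)) blast
    have lb: "linear_form ?b p = c0 * \<alpha> + c1 * \<beta>" by (simp add: ab linear_form_bilinear l0 l1)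
    show ?thesis
    proof (cases "\<alpha> = 0")
      case True
      then have "\<beta> \<noteq> 0" using ab p by auto
      then show ?thesis using lb val_scale[OF p1W, of \<beta>] by (simp add: ab True v1)
    next
      case False
      have "p = \<alpha> *s (p0 + (\<beta> / \<alpha>) *s p1)" using False by (simp add: ab vec_eq_iff algebra_simps)
      then have "val p = \<alpha> * H (\<beta> / \<alpha>)"
        using val_scale[OF _ False, of "p0 + (\<beta> / \<alpha>) *s p1"] inW[of 1 "\<beta> / \<alpha>"] by (simp add: H_def)
      also have "\<dots> = c0 * \<alpha> + c1 * \<beta>" using False by (simp add: H field_simps)
      finally show ?thesis using lb by simp
    qed
  qed
  then show ?thesis using val by metis
qed

end

text \<open>
  An arc in the kernel of the differential of a lift of \<open>\<Phi>\<close> has, after applying the inverse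
  of \<open>\<Phi>\<close>, a stationary image; up to the scaling of representatives this image is the arc itself.
\<close>

lemma embedding_immersive:
  fixes S :: "(complex^'n) set" and \<Phi> G :: "complex^'n \<Rightarrow> complex^'m"
  assumes emb: "embedding S \<Phi>" and pS: "p \<in> S" and p0: "p \<noteq> 0" and arc: "arc_in S p w \<gamma>"
    and lift: "\<forall>\<^sub>F s in at 0. proj_eq (\<Phi> (\<gamma> s)) (G (\<gamma> s))" "proj_eq (\<Phi> p) (G p)"
    and der: "((\<lambda>s. G (\<gamma> s)) has_vector_derivative 0) (at 0)"
  shows "\<exists>c. w = c *s p"
proof (rule ccontr)
  assume notin: "\<nexists>c. w = c *s p"
  then have "w \<notin> vec.span {p}" by (auto simp: vec.span_singleton)
  from exists_linear_form_vanishing_on_subspace[OF vec.subspace_span this]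
  \<comment> \<open>The form \<open>l\<close> sees the nonradial part of the velocity, while
    \<open>m\<close> normalizes the representative of \<open>p\<close>.\<close>
  obtain l where l: "linear_form l p = 0" "linear_form l w = 1" using vec.span_base by blast
  obtain m where m: "linear_form m p = 1" using linear_form_separates[OF p0] by blast
  obtain Y \<psi> where Y: "morphism S Y \<Phi>" "morphism Y S \<psi>" "\<And>q. q \<in> S \<Longrightarrow> proj_eq (\<psi> (\<Phi> q)) q"
    using emb unfolding embedding_def by blast
  have \<Phi>Y: "\<Phi> q \<in> Y" if "q \<in> S" for q using Y(1) that unfolding morphism_def by blast
  obtain d P where P: "\<And>i. homogeneous_poly d (\<lambda>x. P x $ i)" "P (\<Phi> p) \<noteq> 0"
    "zariski_near Y (\<Phi> p) (\<lambda>q. proj_eq (\<psi> q) (P q))"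
    using Y(2) \<Phi>Y[OF pS] unfolding morphism_def by meson
  obtain b B where B: "homogeneous_poly b B" "B (\<Phi> p) \<noteq> 0"
    "\<And>q. q \<in> Y \<Longrightarrow> B q \<noteq> 0 \<Longrightarrow> proj_eq (\<psi> q) (P q)"
    using P(3) unfolding zariski_near_def by blast
  have key: "proj_eq (P (G q)) q" if "q \<in> S" "proj_eq (\<Phi> q) (G q)" "B (G q) \<noteq> 0" for q
  proof -
    have "B (\<Phi> q) \<noteq> 0" using proj_eq_homogeneous_poly_nonzero[OF B(1) that(2)] that(3) by simp
    then have "proj_eq (\<psi> (\<Phi> q)) (P (\<Phi> q))" using B(3) \<Phi>Y that(1) by blast
    then have "proj_eq (\<psi> (\<Phi> q)) (P (G q))"
      using proj_eq_trans proj_eq_homogeneous_poly[OF P(1) that(2)] by blast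
    then show ?thesis using Y(3)[OF that(1)] proj_eq_trans proj_eq_sym by blast
  qed
  have \<gamma>0: "\<gamma> 0 = p" using arc by (simp add: arc_in_def)
  have arcG: "arc_in UNIV (G p) 0 (\<lambda>s. G (\<gamma> s))" using der \<gamma>0 by (simp add: arc_in_def)
  have BG: "B (G p) \<noteq> 0" using proj_eq_homogeneous_poly_nonzero[OF B(1) lift(2)] B(2) by simp
  have "\<forall>\<^sub>F s in at 0. B (G (\<gamma> s)) \<noteq> 0"
    using regular_at_arc_tendsto[OF regular_at_poly[OF B(1)] _ arcG] BG
    by (intro tendsto_imp_eventually_ne) auto
  moreover have "\<forall>\<^sub>F s in at 0. \<gamma> s \<in> S" using arc by (simp add: arc_in_def)
  ultimately have "\<forall>\<^sub>F s in at 0. proj_eq (P (G (\<gamma> s))) (\<gamma> s)"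
    using lift(1) by eventually_elim (rule key)
  moreover have at_p: "proj_eq (P (G p)) p" using key[OF pS lift(2) BG] .
  ultimately have "\<forall>\<^sub>F s in nhds 0. proj_eq (P (G (\<gamma> s))) (\<gamma> s)"
    by (simp add: eventually_nhds_conv_at \<gamma>0)
  \<comment> \<open>Proportionality of two vectors, expressed by a minor so that the unknown scalar
    disappears. Differentiating at 0, where \<open>P\<close> along the lifted arc is stationary,
    leaves \<open>linear_form m (P (G p))\<close> on the left and 0 on the right; but
    \<open>P (G p)\<close> is a nonzero multiple of \<open>p\<close>.\<close>
  then have eq: "\<forall>\<^sub>F s in nhds 0. linear_form m (P (G (\<gamma> s))) * linear_form l (\<gamma> s) =
      linear_form l (P (G (\<gamma> s))) * linear_form m (\<gamma> s)"
    by eventually_elim (auto simp: proj_eq_def linear_form_bilinear)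
  have dP: "((\<lambda>s. linear_form a (P (G (\<gamma> s)))) has_vector_derivative 0) (at 0)" for a
  proof -
    obtain D where "((\<lambda>x. linear_form a (P x)) has_derivative linear_form D) (at (G p))"
      using homogeneous_poly_has_derivative[OF homogeneous_poly_linear_form_comp[of d P a, OF P(1)]] by blast
    from arc_in_has_vector_derivative[OF arcG this] show ?thesis by (simp add: linear_form_bilinear)
  qed
  have dl: "((\<lambda>s. linear_form a (\<gamma> s)) has_vector_derivative linear_form a w) (at 0)" for a
    by (rule arc_in_has_vector_derivative[OF arc linear_form_has_derivative])
  have "((\<lambda>s. linear_form m (P (G (\<gamma> s))) * linear_form l (\<gamma> s)) has_vector_derivative
      linear_form m (P (G p))) (at 0)"
    using has_vector_derivative_mult[OF dP[of m] dl[of l]] by (simp add: \<gamma>0 l)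
  moreover have "((\<lambda>s. linear_form l (P (G (\<gamma> s))) * linear_form m (\<gamma> s)) has_vector_derivative
      linear_form l (P (G p)) * linear_form m w) (at 0)"
    using has_vector_derivative_mult[OF dP[of l] dl[of m]] by (simp add: \<gamma>0)
  moreover have "linear_form l (P (G p)) = 0" "linear_form m (P (G p)) \<noteq> 0"
    using at_p l m by (auto simp: proj_eq_def linear_form_bilinear)
  moreover have "((\<lambda>s. linear_form m (P (G (\<gamma> s))) * linear_form l (\<gamma> s)) has_vector_derivative 0) (at 0) \<longleftrightarrow>
      ((\<lambda>s. linear_form l (P (G (\<gamma> s))) * linear_form m (\<gamma> s)) has_vector_derivative 0) (at 0)"
    using eq by (intro has_vector_derivative_cong_ev) (auto dest: eventually_nhds_x_imp_x)
  ultimately show False using vector_derivative_unique_at by fastforce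
qed

context line_on_surface
begin

section \<open>Base points on the line\<close>

lemma equation_zero: "p \<in> W - {0} \<Longrightarrow> h p = 0"
  using equation[of p] line_subset zariski_near_at[of S p "\<lambda>q. q \<in> W - {0} \<longrightarrow> h q = 0"]
  unfolding local_equation_def by blast

text \<open>The unit \<open>e\<close> relating \<open>h'\<close> to \<open>h\<close> is chosen
  before \<open>t\<close>, \<open>a\<close> and \<open>g\<close>. Hence all coordinates of a map are
  multiplied by the same factor, and the projective point does not change.\<close>

lemma quot_of_local_equation:
  assumes p: "p \<in> W - {0}" and h': "local_equation S (W - {0}) p h'"
  shows "\<exists>e. regular_at S 0 p e \<and> e p \<noteq> 0 \<and> (\<forall>t a g. regular_at S 1 p g \<and>
      zariski_near S p (\<lambda>q. linear_form a q = h' q ^ t * g q) \<longrightarrow> quot t a p (\<lambda>q. e q ^ t * g q))"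
proof -
  obtain e where e: "regular_at S 0 p e" "zariski_near S p (\<lambda>q. h' q = h q * e q)" "e p \<noteq> 0"
    using local_equation_unit[OF p h'] by blast
  have "quot t a p (\<lambda>q. e q ^ t * g q)"
    if g: "regular_at S 1 p g" "zariski_near S p (\<lambda>q. linear_form a q = h' q ^ t * g q)" for t a g
    unfolding quot_def
  proof
    show "regular_at S 1 p (\<lambda>q. e q ^ t * g q)"
      using regular_at_mult[OF regular_at_power[OF e(1)] g(1)] by simp
    show "zariski_near S p (\<lambda>q. linear_form a q = h q ^ t * (e q ^ t * g q))"
      using g(2) e(2) by (rule zariski_near_mono2) (simp add: power_mult_distrib)
  qed
  with e show ?thesis by (intro exI[of _ e]) simp
qed

lemma quot_sections_minus:
  assumes "a \<in> sections_minus S (W - {0}) t" "p \<in> W - {0}"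
  shows "\<exists>g. quot t a p g"
proof -
  have "p \<in> S" using assms(2) line_subset by blast
  then obtain h' g where g: "local_equation S (W - {0}) p h'" "regular_at S 1 p g"
    "zariski_near S p (\<lambda>q. linear_form a q = h' q ^ t * g q)"
    using assms(1) unfolding sections_minus_def by blast
  from quot_of_local_equation[OF assms(2) g(1)]
  obtain e where e: "\<forall>t a g. regular_at S 1 p g \<and>
      zariski_near S p (\<lambda>q. linear_form a q = h' q ^ t * g q) \<longrightarrow> quot t a p (\<lambda>q. e q ^ t * g q)"
    by (elim exE conjE)
  from e[THEN spec, THEN spec, THEN spec, THEN mp, OF conjI[OF g(2,3)]] show ?thesis
    by (rule exI[of _ "\<lambda>q. e q ^ t * g q"])
qed

text \<open>At points of the line the quotient vanishes along the line and is therefore divisible by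
  \<open>h\<close> once more; the form \<open>m\<close> turns it into a germ of degree 0, to which
  the definition of a local equation applies. Elsewhere the equation of the line is a unit.\<close>

lemma sections_minus_Suc:
  assumes a: "a \<in> sections_minus S (W - {0}) t"
    and vanish: "\<And>p g. p \<in> W - {0} \<Longrightarrow> quot t a p g \<Longrightarrow> g p = 0"
  shows "a \<in> sections_minus S (W - {0}) (Suc t)"
proof -
  have "\<exists>h g. local_equation S (W - {0}) p h \<and> regular_at S 1 p g \<and>
            zariski_near S p (\<lambda>q. linear_form a q = h q ^ Suc t * g q)" if pS: "p \<in> S" for p
  proof (cases "p \<in> W")
    case True
    then have p: "p \<in> W - {0}" using pS zero_notin by auto
    obtain g where g: "quot t a p g" using quot_sections_minus[OF a p] by blast
    obtain m where m: "linear_form m p = 1" using linear_form_separates p by blast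
    have "regular_at S 0 p (\<lambda>q. g q / linear_form m q)"
      by (rule regular_at_divide_linear_form) (use g m in \<open>auto simp: quot_def\<close>)
    moreover have "zariski_near S p (\<lambda>q. q \<in> W - {0} \<longrightarrow> g q / linear_form m q = 0)"
      by (rule zariski_near_mono[OF quot_open[OF g]]) (use vanish in auto)
    ultimately obtain e where e: "regular_at S 0 p e"
      "zariski_near S p (\<lambda>q. g q / linear_form m q = h q * e q)"
      using equation[OF p] unfolding local_equation_def by blast
    have "regular_at S 1 p (\<lambda>q. e q * linear_form m q)"
      using regular_at_mult[OF e(1) regular_at_linear_form] by simp
    moreover have "zariski_near S p (\<lambda>q. linear_form m q \<noteq> 0)"
      by (rule zariski_near_nonzero[OF homogeneous_poly_linear_form]) (simp add: m)
    then have eq: "zariski_near S p (\<lambda>q. g q = h q * e q * linear_form m q)"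
      by (rule zariski_near_mono2[OF _ e(2)]) (simp add: field_simps)
    have "zariski_near S p (\<lambda>q. linear_form a q = h q ^ Suc t * (e q * linear_form m q))"
      by (rule zariski_near_mono2[OF _ eq, of "\<lambda>q. linear_form a q = h q ^ t * g q"])
        (use g in \<open>simp_all add: quot_def\<close>)
    ultimately show ?thesis using equation[OF p] by blast
  next
    \<comment> \<open>Near \<open>p\<close> there are no points of \<open>W\<close>, so the constant
      1 belongs to the ideal and \<open>h'\<close> has an inverse \<open>e\<close>. Multiplying by
      \<open>h' q * e q = 1\<close> raises the exponent.\<close>
    case False
    obtain h' g where g: "local_equation S (W - {0}) p h'" "regular_at S 1 p g"
      "zariski_near S p (\<lambda>q. linear_form a q = h' q ^ t * g q)"
      using a pS unfolding sections_minus_def by blast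
    obtain l where l: "\<forall>y\<in>W. linear_form l y = 0" "linear_form l p = 1"
      using exists_linear_form_vanishing_on_subspace[OF subspace False] by blast
    have "zariski_near S p (\<lambda>q. linear_form l q \<noteq> 0)"
      by (rule zariski_near_nonzero[OF homogeneous_poly_linear_form]) (simp add: l)
    then have "zariski_near S p (\<lambda>q. q \<in> W - {0} \<longrightarrow> (1::complex) = 0)"
      by (rule zariski_near_mono) (use l in auto)
    then obtain e where e: "regular_at S 0 p e" "zariski_near S p (\<lambda>q. 1 = h' q * e q)"
      using g(1) regular_at_const[of S p 1] unfolding local_equation_def by blast
    have "regular_at S 1 p (\<lambda>q. e q * g q)" using regular_at_mult[OF e(1) g(2)] by simp
    moreover have "zariski_near S p (\<lambda>q. linear_form a q = h' q ^ Suc t * (e q * g q))"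
    proof (rule zariski_near_mono2[OF g(3) e(2)])
      fix q assume q: "linear_form a q = h' q ^ t * g q" "1 = h' q * e q"
      have "h' q ^ Suc t * (e q * g q) = h' q ^ t * g q * (h' q * e q)" by simp
      then show "linear_form a q = h' q ^ Suc t * (e q * g q)" using q by simp
    qed
    ultimately show ?thesis using g(1) by blast
  qed
  then show ?thesis unfolding sections_minus_def by blast
qed

lemma very_ample_lift:
  assumes "very_ample_minus S (W - {0}) t" "p \<in> W - {0}"
  obtains \<sigma> :: "'n \<Rightarrow> complex^'n" and \<Phi> G :: "complex^'n \<Rightarrow> complex^'n"
  where "vec.span (range \<sigma>) = sections_minus S (W - {0}) t" "embedding S \<Phi>"
    "\<forall>i. quot t (\<sigma> i) p (\<lambda>q. G q $ i)" "G p \<noteq> 0" "\<forall>\<^sub>F q in nhds p. q \<in> S \<longrightarrow> proj_eq (\<Phi> q) (G q)"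
proof -
  obtain \<sigma> :: "'n \<Rightarrow> complex^'n" and \<Phi> :: "complex^'n \<Rightarrow> complex^'n"
    where \<sigma>: "vec.span (range \<sigma>) = sections_minus S (W - {0}) t" "defines_map S (W - {0}) t \<sigma> \<Phi>" "embedding S \<Phi>"
    using assms(1) unfolding very_ample_minus_def by blast
  have pS: "p \<in> S" using assms(2) line_subset by blast
  obtain h' G where G: "local_equation S (W - {0}) p h'" "\<And>i. regular_at S 1 p (\<lambda>q. G q $ i)" "G p \<noteq> 0"
    "zariski_near S p (\<lambda>q. (\<forall>i. linear_form (\<sigma> i) q = h' q ^ t * G q $ i) \<and> proj_eq (\<Phi> q) (G q))"
    using \<sigma>(2) pS unfolding defines_map_def by meson
  from quot_of_local_equation[OF assms(2) G(1)]
  obtain e where e: "regular_at S 0 p e" "e p \<noteq> 0" "\<forall>t a g. regular_at S 1 p g \<and>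
      zariski_near S p (\<lambda>q. linear_form a q = h' q ^ t * g q) \<longrightarrow> quot t a p (\<lambda>q. e q ^ t * g q)"
    by (elim exE conjE)
  obtain \<phi> D where \<phi>: "(\<phi> has_derivative linear_form D) (at p)" "\<forall>\<^sub>F q in nhds p. q \<in> S \<longrightarrow> e q = \<phi> q"
    using regular_at_has_derivative[OF e(1)] by blast
  \<comment> \<open>The unit \<open>e\<close> is controlled only on S, so its nonvanishing near
    \<open>p\<close> is obtained from the continuous extension \<open>\<phi>\<close>.\<close>
  have "\<phi> p \<noteq> 0" using \<phi>(2) pS e(2) eventually_nhds_x_imp_x by force
  moreover have "(\<phi> \<longlongrightarrow> \<phi> p) (nhds p)"
    using has_derivative_continuous[OF \<phi>(1)] by (simp add: continuous_at tendsto_at_iff_tendsto_nhds)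
  ultimately have ne: "\<forall>\<^sub>F q in nhds p. \<phi> q \<noteq> 0" by (rule tendsto_imp_eventually_ne[rotated])
  let ?G = "\<lambda>q. e q ^ t *s G q"
  show ?thesis
  proof (rule that[OF \<sigma>(1,3)])
    show "\<forall>i. quot t (\<sigma> i) p (\<lambda>q. ?G q $ i)"
    proof
      fix i
      have "zariski_near S p (\<lambda>q. linear_form (\<sigma> i) q = h' q ^ t * G q $ i)"
        by (rule zariski_near_mono[OF G(4)]) blast
      with G(2)[of i] have "quot t (\<sigma> i) p (\<lambda>q. e q ^ t * G q $ i)"
        by (intro e(3)[rule_format] conjI)
      then show "quot t (\<sigma> i) p (\<lambda>q. ?G q $ i)" by simp
    qed
    show "?G p \<noteq> 0" using e(2) G(3) by (simp add: vector_mul_eq_0)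
    show "\<forall>\<^sub>F q in nhds p. q \<in> S \<longrightarrow> proj_eq (\<Phi> q) (?G q)"
      using ne \<phi>(2) zariski_near_eventually[OF G(4)]
    proof eventually_elim
      case (elim q)
      show ?case
      proof
        assume q: "q \<in> S"
        then have "proj_eq (G q) (?G q)" unfolding proj_eq_def using elim
          by (intro exI[of _ "1 / e q ^ t"]) (simp add: vector_smult_assoc)
        then show "proj_eq (\<Phi> q) (?G q)" using elim q proj_eq_trans by blast
      qed
    qed
  qed
qed

definition base_point_free :: "nat \<Rightarrow> bool" where
  "base_point_free t \<longleftrightarrow>
     (\<forall>p\<in>W - {0}. \<exists>a\<in>sections_minus S (W - {0}) t. \<exists>g. quot t a p g \<and> g p \<noteq> 0)"

lemma very_ample_base_point_free:
  assumes "very_ample_minus S (W - {0}) t"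
  shows "base_point_free t"
  unfolding base_point_free_def
proof
  fix p assume p: "p \<in> W - {0}"
  obtain \<sigma> :: "'n \<Rightarrow> complex^'n" and \<Phi> G :: "complex^'n \<Rightarrow> complex^'n" where G:
    "vec.span (range \<sigma>) = sections_minus S (W - {0}) t" "embedding S \<Phi>"
    "\<forall>i. quot t (\<sigma> i) p (\<lambda>q. G q $ i)" "G p \<noteq> 0" "\<forall>\<^sub>F q in nhds p. q \<in> S \<longrightarrow> proj_eq (\<Phi> q) (G q)"
    by (rule very_ample_lift[OF assms p])
  obtain i where "G p $ i \<noteq> 0" using G(4) by (auto simp: vec_eq_iff)
  moreover have "\<sigma> i \<in> sections_minus S (W - {0}) t"
    unfolding G(1)[symmetric] by (rule vec.span_base) simp
  ultimately show "\<exists>a\<in>sections_minus S (W - {0}) t. \<exists>g. quot t a p g \<and> g p \<noteq> 0"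
    using G(3) by (intro bexI[of _ "\<sigma> i"] exI[of _ "\<lambda>q. G q $ i"] conjI) simp_all
qed

end

context line_on_surface
begin

text \<open>
  A section of \<open>V - t D\<close> vanishing on \<open>D\<close>, but not to second order at \<open>p\<close>, exists because the map
  of \<open>V - t D\<close> is an immersion which sends \<open>D\<close> to a line.
\<close>

lemma very_ample_base_point_free_Suc:
  assumes va: "very_ample_minus S (W - {0}) t"
  shows "base_point_free (Suc t)"
  unfolding base_point_free_def
proof
  fix p assume p: "p \<in> W - {0}"
  then have pS: "p \<in> S" and pW: "p \<in> W" and p0: "p \<noteq> 0" using line_subset by auto
  obtain \<sigma> :: "'n \<Rightarrow> complex^'n" and \<Phi> G :: "complex^'n \<Rightarrow> complex^'n" where G:
    "vec.span (range \<sigma>) = sections_minus S (W - {0}) t" "embedding S \<Phi>"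
    "\<forall>i. quot t (\<sigma> i) p (\<lambda>q. G q $ i)" "G p \<noteq> 0" "\<forall>\<^sub>F q in nhds p. q \<in> S \<longrightarrow> proj_eq (\<Phi> q) (G q)"
    by (rule very_ample_lift[OF va p])
  have \<sigma>: "\<sigma> i \<in> sections_minus S (W - {0}) t" for i
    unfolding G(1)[symmetric] by (rule vec.span_base) simp
  have reg: "regular_at S 1 p (\<lambda>q. G q $ i)" for i using G(3) by (simp add: quot_def)
  have "\<exists>b. \<forall>p\<in>W - {0}. \<forall>g. quot t (\<sigma> i) p g \<longrightarrow> g p = linear_form b p" for i
    by (rule quot_linear_form) (rule quot_sections_minus[OF \<sigma>])
  then obtain b where b: "\<And>i p g. p \<in> W - {0} \<Longrightarrow> quot t (\<sigma> i) p g \<Longrightarrow> g p = linear_form (b i) p"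
    by metis
  have "\<exists>D. \<forall>w \<gamma>. arc_in S p w \<gamma> \<longrightarrow>
      ((\<lambda>s. G (\<gamma> s) $ i) has_vector_derivative linear_form D w) (at 0)" for i
    by (rule regular_at_arc_derivative[OF reg pS])
  then obtain D where D: "\<And>i w \<gamma>. arc_in S p w \<gamma> \<Longrightarrow>
      ((\<lambda>s. G (\<gamma> s) $ i) has_vector_derivative linear_form (D i) w) (at 0)"
    by metis
  \<comment> \<open>On the line each coordinate of \<open>G\<close> is a linear form
    \<open>b i\<close>, so in directions of \<open>W\<close> its differential is that same
    form.\<close>
  have DW: "linear_form (D i) w = linear_form (b i) w" if w: "w \<in> W" for i w
  proof -
    let ?\<gamma> = "\<lambda>s. p + s *\<^sub>R w"
    have arc: "arc_in S p w ?\<gamma>" by (rule arc_on_line[OF p w])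
    have "\<forall>\<^sub>F s in at 0. ?\<gamma> s \<in> W - {0}"
    proof -
      have "\<forall>\<^sub>F s in at 0. ?\<gamma> s \<in> S" using arc by (simp add: arc_in_def)
      then show ?thesis
      proof eventually_elim
        case (elim s)
        have "?\<gamma> s \<in> W" using pW w subspace
          by (simp add: scaleR_vec_conv_vector_scalar_mult vec.subspace_add vec.subspace_scale)
        then show ?case using elim zero_notin by auto
      qed
    qed
    moreover have "quot t (\<sigma> i) p (\<lambda>q. G q $ i)" using G(3) by simp
    note arc_in_eventually[OF arc zariski_near_eventually[OF quot_open[OF this]]]
    ultimately have "\<forall>\<^sub>F s in at 0. G (?\<gamma> s) $ i = linear_form (b i) (?\<gamma> s)"
      by eventually_elim (rule b)
    moreover have "G (?\<gamma> 0) $ i = linear_form (b i) (?\<gamma> 0)"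
      using b[OF p G(3)[THEN spec], of i] by simp
    moreover have "((\<lambda>s. linear_form (b i) (?\<gamma> s)) has_vector_derivative linear_form (b i) w) (at 0)"
      by (rule arc_in_has_vector_derivative[OF arc linear_form_has_derivative])
    ultimately have "((\<lambda>s. G (?\<gamma> s) $ i) has_vector_derivative linear_form (b i) w) (at 0)"
      by (rule has_vector_derivative_cong_at)
    from vector_derivative_unique_at[OF D[OF arc] this] show ?thesis .
  qed
  obtain T where T: "vec.subspace T" "W \<subset> T" "\<forall>w\<in>T. \<exists>\<gamma>. arc_in S p w \<gamma>"
    using tangent_space[OF p] by blast
  then obtain w where w: "w \<in> T" "w \<notin> W" by blast
  obtain \<gamma> where \<gamma>: "arc_in S p w \<gamma>" using T(3) w(1) by blast
  \<comment> \<open>\<open>L\<close> is the linear map that \<open>G\<close> induces on the line,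
    and \<open>u\<close> is the derivative of \<open>G\<close> in the transversal direction
    \<open>w\<close>.\<close>
  define L where "L y = (\<chi> i. linear_form (b i) y)" for y
  define u where "u = (\<chi> i. linear_form (D i) w)"
  have "vec.subspace (L ` W)"
  proof (rule vec.subspaceI)
    show "0 \<in> L ` W" using vec.subspace_0[OF subspace]
      by (intro image_eqI[of _ _ 0]) (simp_all add: L_def vec_eq_iff linear_form_bilinear)
    show "x + y \<in> L ` W" if xy: "x \<in> L ` W" "y \<in> L ` W" for x y
    proof -
      obtain x' y' where "x' \<in> W" "y' \<in> W" "x = L x'" "y = L y'" using xy by blast
      then show ?thesis using vec.subspace_add[OF subspace]
        by (intro image_eqI[of _ _ "x' + y'"]) (simp_all add: L_def vec_eq_iff linear_form_bilinear)
    qed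
    show "c *s x \<in> L ` W" if x: "x \<in> L ` W" for c x
    proof -
      obtain x' where "x' \<in> W" "x = L x'" using x by blast
      then show ?thesis using vec.subspace_scale[OF subspace]
        by (intro image_eqI[of _ _ "c *s x'"]) (simp_all add: L_def vec_eq_iff linear_form_bilinear)
    qed
  qed
  \<comment> \<open>If \<open>u = L w0\<close> with \<open>w0\<close> in \<open>W\<close>, then
    \<open>G\<close> is stationary along an arc with velocity \<open>w - w0\<close>. Immersivity
    makes this velocity radial, which would put \<open>w\<close> into \<open>W\<close>.\<close>
  moreover have "u \<notin> L ` W"
  proof
    assume "u \<in> L ` W"
    then obtain w0 where w0: "w0 \<in> W" "u = L w0" by blast
    then have "w - w0 \<in> T" using T(1,2) w(1) vec.subspace_diff by blast
    then obtain \<eta> where \<eta>: "arc_in S p (w - w0) \<eta>" using T(3) by blast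
    have "linear_form (D i) (w - w0) = 0" for i
    proof -
      have "linear_form (D i) w = linear_form (b i) w0"
        using w0(2) by (simp add: u_def L_def vec_eq_iff)
      then show ?thesis using DW[OF w0(1)] by (simp add: linear_form_bilinear)
    qed
    then have "((\<lambda>s. G (\<eta> s)) has_vector_derivative 0) (at 0)"
      using D[OF \<eta>] by (intro has_vector_derivative_vec) simp
    moreover have "\<forall>\<^sub>F s in at 0. proj_eq (\<Phi> (\<eta> s)) (G (\<eta> s))"
      by (rule arc_in_eventually[OF \<eta> G(5)])
    moreover have "proj_eq (\<Phi> p) (G p)" using eventually_nhds_x_imp_x[OF G(5)] pS by simp
    ultimately obtain c where "w - w0 = c *s p"
      using embedding_immersive[OF G(2) pS p0 \<eta>] by blast
    then have "w = w0 + c *s p" by (simp add: diff_eq_eq add.commute)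
    then have "w \<in> W" using w0(1) pW subspace by (simp add: vec.subspace_add vec.subspace_scale)
    then show False using w(2) by simp
  qed
  ultimately obtain c where c: "\<forall>y\<in>L ` W. linear_form c y = 0" "linear_form c u = 1"
    using exists_linear_form_vanishing_on_subspace by blast
  \<comment> \<open>The hyperplane \<open>c\<close> contains the image of the line but not
    \<open>u\<close>. It corresponds to a section whose quotient \<open>g\<close> vanishes on the
    line and has derivative 1 along \<open>\<gamma>\<close>.\<close>
  define a where "a = (\<Sum>i\<in>UNIV. c $ i *s \<sigma> i)"
  define g where "g q = (\<Sum>i\<in>UNIV. c $ i * G q $ i)" for q
  have qa: "quot t a p g" unfolding a_def g_def[abs_def] using G(3) by (intro quot_sum) simp
  have "a \<in> vec.span (range \<sigma>)"
    unfolding a_def by (intro vec.span_sum vec.span_scale vec.span_base) simp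
  then have "a \<in> sections_minus S (W - {0}) t" using G(1) by simp
  then have aS: "a \<in> sections_minus S (W - {0}) (Suc t)"
  proof (rule sections_minus_Suc)
    fix p' g' assume p': "p' \<in> W - {0}" and g': "quot t a p' g'"
    obtain \<tau> where \<tau>: "\<And>i. quot t (\<sigma> i) p' (\<tau> i)" using quot_sections_minus[OF \<sigma> p'] by metis
    have "quot t a p' (\<lambda>q. \<Sum>i\<in>UNIV. c $ i * \<tau> i q)"
      unfolding a_def using \<tau> by (intro quot_sum) simp
    from quot_unique[OF p' g' this] have "g' p' = (\<Sum>i\<in>UNIV. c $ i * \<tau> i p')" .
    also have "\<dots> = linear_form c (L p')" using b[OF p' \<tau>] by (simp add: linear_form_def[of c] L_def)
    finally show "g' p' = 0" using c(1) p' by simp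
  qed
  obtain g2 where g2: "quot (Suc t) a p g2" using quot_sections_minus[OF aS p] by blast
  \<comment> \<open>Along \<open>\<gamma>\<close> one has \<open>g = h * g2\<close> off 0. If
    \<open>g2 p\<close> were 0, both factors would vanish at \<open>p\<close> and the product would
    have derivative 0 instead of 1.\<close>
  have "g2 p \<noteq> 0"
  proof
    assume g2p: "g2 p = 0"
    have hp: "h p = 0" by (rule equation_zero[OF p])
    have "((\<lambda>s. g (\<gamma> s)) has_vector_derivative (\<Sum>i\<in>UNIV. c $ i * linear_form (D i) w)) (at 0)"
      unfolding g_def by (intro has_vector_derivative_sum has_vector_derivative_mult_right D \<gamma>)
    moreover have "(\<Sum>i\<in>UNIV. c $ i * linear_form (D i) w) = 1"
      using c(2) by (simp add: linear_form_def[of c] u_def)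
    ultimately have dg: "((\<lambda>s. g (\<gamma> s)) has_vector_derivative 1) (at 0)" by simp
    obtain Dh where Dh: "((\<lambda>s. h (\<gamma> s)) has_vector_derivative linear_form Dh w) (at 0)"
      using regular_at_arc_derivative[OF local_equation_regular_at[OF equation[OF p]] pS] \<gamma> by blast
    have "regular_at S 1 p g2" using g2 by (simp add: quot_def)
    from regular_at_arc_derivative[OF this pS]
    obtain D2 where D2: "((\<lambda>s. g2 (\<gamma> s)) has_vector_derivative linear_form D2 w) (at 0)"
      using \<gamma> by blast
    have \<gamma>0: "\<gamma> 0 = p" using \<gamma> by (simp add: arc_in_def)
    have "((\<lambda>s. h (\<gamma> s) * g2 (\<gamma> s)) has_vector_derivative 0) (at 0)"
      using has_vector_derivative_mult[OF Dh D2] by (simp add: \<gamma>0 hp g2p)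
    moreover have "g p = h p * g2 p"
    proof -
      have "(\<Sum>i\<in>UNIV. c $ i * G p $ i) = linear_form c (L p)"
        using b[OF p G(3)[THEN spec]] by (simp add: linear_form_def[of c] L_def)
      then show ?thesis using c(1) pW by (simp add: g_def hp)
    qed
    moreover have "\<forall>\<^sub>F s in at 0. g (\<gamma> s) = h (\<gamma> s) * g2 (\<gamma> s)"
    proof -
      have "\<forall>\<^sub>F s in at 0. linear_form a (\<gamma> s) = h (\<gamma> s) ^ t * g (\<gamma> s)"
        "\<forall>\<^sub>F s in at 0. linear_form a (\<gamma> s) = h (\<gamma> s) ^ Suc t * g2 (\<gamma> s)"
        using qa g2 by (auto simp: quot_def intro!: arc_in_eventually[OF \<gamma> zariski_near_eventually])
      then show ?thesis using equation_nonzero[OF p equation[OF p] \<gamma> w(2)]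
        by eventually_elim (simp add: mult.assoc)
    qed
    ultimately have "((\<lambda>s. g (\<gamma> s)) has_vector_derivative 0) (at 0)"
      by (intro has_vector_derivative_cong_at[of "\<lambda>s. g (\<gamma> s)" "\<lambda>s. h (\<gamma> s) * g2 (\<gamma> s)"]) (simp_all add: \<gamma>0)
    from vector_derivative_unique_at[OF dg this] show False by simp
  qed
  then show "\<exists>a\<in>sections_minus S (W - {0}) (Suc t). \<exists>g. quot (Suc t) a p g \<and> g p \<noteq> 0"
    using aS g2 by blast
qed

text \<open>A section \<open>a\<close> nonzero at \<open>x\<close> restricts to a linear form with a
  zero elsewhere on the line. A section nonzero at that zero, corrected by a multiple of
  \<open>a\<close> so as to vanish at \<open>x\<close>, is still not identically zero on the line;
  being linear there, it has nonzero derivative \<open>\<kappa>\<close> along the line at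
  \<open>x\<close>.\<close>

lemma base_point_free_two_sections:
  assumes bpf: "base_point_free t" and x: "x \<in> W - {0}"
    and x1: "x1 \<in> W" "\<And>\<alpha> \<beta>. \<alpha> *s x + \<beta> *s x1 = 0 \<Longrightarrow> \<alpha> = 0 \<and> \<beta> = 0"
  shows "\<exists>a b g g' \<kappa>. quot t a x g \<and> g x \<noteq> 0 \<and> quot t b x g' \<and> g' x = 0 \<and> \<kappa> \<noteq> 0 \<and>
    ((\<lambda>s. g' (x + s *\<^sub>R x1)) has_vector_derivative \<kappa>) (at 0)"
proof -
  let ?V = "sections_minus S (W - {0}) t"
  obtain a g where a: "a \<in> ?V" "quot t a x g" "g x \<noteq> 0"
    using bpf x unfolding base_point_free_def by blast
  obtain la where la: "\<forall>p\<in>W - {0}. \<forall>g. quot t a p g \<longrightarrow> g p = linear_form la p"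
    using quot_linear_form[OF quot_sections_minus[OF a(1)]] by blast
  have lax: "linear_form la x \<noteq> 0" using la x a by auto
  \<comment> \<open>The zero on the line of the restriction \<open>la\<close> of \<open>a\<close>,
    unique up to scaling.\<close>
  define p where "p = (- linear_form la x1) *s x + linear_form la x *s x1"
  have "p \<noteq> 0" using x1(2)[of "- linear_form la x1" "linear_form la x"] lax by (auto simp: p_def)
  moreover have "p \<in> W" using x x1(1) subspace
    unfolding p_def by (intro vec.subspace_add vec.subspace_scale) auto
  ultimately have p: "p \<in> W - {0}" by simp
  have lap: "linear_form la p = 0" by (simp add: p_def linear_form_bilinear)
  obtain a' g1 where a': "a' \<in> ?V" "quot t a' p g1" "g1 p \<noteq> 0"
    using bpf p unfolding base_point_free_def by blast
  obtain la' where la': "\<forall>p\<in>W - {0}. \<forall>g. quot t a' p g \<longrightarrow> g p = linear_form la' p"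
    using quot_linear_form[OF quot_sections_minus[OF a'(1)]] by blast
  have la'p: "linear_form la' p \<noteq> 0" using la' p a' by auto
  define c where "c = - linear_form la' x / linear_form la x"
  define b lb where "b = 1 *s a' + c *s a" and "lb = la' + c *s la"
  have lb: "g p = linear_form lb p" if q: "q \<in> W - {0}" "quot t b q g" "p = q" for p q g
  proof -
    obtain g2 g3 where g: "quot t a' q g2" "quot t a q g3"
      using quot_sections_minus[OF a'(1) q(1)] quot_sections_minus[OF a(1) q(1)] by blast
    from quot_unique[OF q(1,2) quot_linear_combination[OF g, of 1 c, folded b_def]]
    have "g q = g2 q + c * g3 q" by simp
    also have "g2 q = linear_form la' q" using la' q(1) g(1) by blast
    also have "g3 q = linear_form la q" using la q(1) g(2) by blast
    finally show ?thesis by (simp add: lb_def linear_form_bilinear q(3))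
  qed
  have lbx: "linear_form lb x = 0" using lax by (simp add: lb_def c_def linear_form_bilinear)
  have "linear_form lb p \<noteq> 0" using la'p lap by (simp add: lb_def linear_form_bilinear)
  then have lbx1: "linear_form lb x1 \<noteq> 0" using lbx by (auto simp: p_def linear_form_bilinear)
  obtain g2 where g2: "quot t a' x g2" using quot_sections_minus[OF a'(1) x] by blast
  define g' where "g' q = 1 * g2 q + c * g q" for q
  have g': "quot t b x g'" unfolding b_def g'_def[abs_def]
    by (rule quot_linear_combination[OF g2 a(2)])
  have g'x: "g' x = 0" using lb[OF x g' refl] lbx by simp
  let ?\<gamma> = "\<lambda>s. x + s *\<^sub>R x1"
  have arc: "arc_in S x x1 ?\<gamma>" by (rule arc_on_line[OF x x1(1)])
  have "\<forall>\<^sub>F s in at 0. ?\<gamma> s \<in> S" using arc by (simp add: arc_in_def)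
  with arc_in_eventually[OF arc zariski_near_eventually[OF quot_open[OF g']]]
  have "\<forall>\<^sub>F s in at 0. g' (?\<gamma> s) = linear_form lb (?\<gamma> s)"
  proof eventually_elim
    case (elim s)
    have "?\<gamma> s \<in> W" using x x1 subspace
      by (simp add: scaleR_vec_conv_vector_scalar_mult vec.subspace_add vec.subspace_scale)
    then have "?\<gamma> s \<in> W - {0}" using elim zero_notin by auto
    from lb[OF this elim(1) refl] show ?case .
  qed
  moreover have "g' (?\<gamma> 0) = linear_form lb (?\<gamma> 0)" by (simp add: g'x lbx)
  moreover have "((\<lambda>s. linear_form lb (?\<gamma> s)) has_vector_derivative linear_form lb x1) (at 0)"
    by (rule arc_in_has_vector_derivative[OF arc linear_form_has_derivative])
  ultimately have "((\<lambda>s. g' (?\<gamma> s)) has_vector_derivative linear_form lb x1) (at 0)"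
    by (rule has_vector_derivative_cong_at)
  then have "quot t a x g \<and> g x \<noteq> 0 \<and> quot t b x g' \<and> g' x = 0 \<and> linear_form lb x1 \<noteq> 0 \<and>
    ((\<lambda>s. g' (x + s *\<^sub>R x1)) has_vector_derivative linear_form lb x1) (at 0)"
    using a g' g'x lbx1 by simp
  then show ?thesis by (intro exI)
qed

end

subsection \<open>Jets\<close>

text \<open>
  Membership in a power of the maximal ideal is only used through vanishing orders along arcs.
\<close>

definition arc_vanishing :: "(complex^'n) set \<Rightarrow> nat \<Rightarrow> complex^'n \<Rightarrow> (complex^'n) set" where
  "arc_vanishing S n x = {a. \<forall>w \<gamma>. arc_in S x w \<gamma> \<longrightarrow>
     (\<exists>C. \<forall>\<^sub>F s in at 0. cmod (linear_form a (\<gamma> s)) \<le> C * \<bar>s\<bar> ^ n)}"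

lemma arc_vanishing_subspace: "vec.subspace (arc_vanishing S n x)"
proof (rule vec.subspaceI)
  show "0 \<in> arc_vanishing S n x"
    unfolding arc_vanishing_def by (auto simp: linear_form_bilinear intro!: exI[of _ 0])
  show "a + b \<in> arc_vanishing S n x"
    if ab: "a \<in> arc_vanishing S n x" "b \<in> arc_vanishing S n x" for a b
    unfolding arc_vanishing_def
  proof (intro CollectI allI impI)
    fix w \<gamma> assume arc: "arc_in S x w \<gamma>"
    obtain A where A: "\<forall>\<^sub>F s in at 0. cmod (linear_form a (\<gamma> s)) \<le> A * \<bar>s\<bar> ^ n"
      using ab(1) arc unfolding arc_vanishing_def by blast
    obtain B where B: "\<forall>\<^sub>F s in at 0. cmod (linear_form b (\<gamma> s)) \<le> B * \<bar>s\<bar> ^ n"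
      using ab(2) arc unfolding arc_vanishing_def by blast
    from A B have "\<forall>\<^sub>F s in at 0. cmod (linear_form (a + b) (\<gamma> s)) \<le> (A + B) * \<bar>s\<bar> ^ n"
    proof eventually_elim
      case (elim s)
      then show ?case using norm_triangle_ineq[of "linear_form a (\<gamma> s)" "linear_form b (\<gamma> s)"]
        by (simp add: linear_form_bilinear distrib_right)
    qed
    then show "\<exists>C. \<forall>\<^sub>F s in at 0. cmod (linear_form (a + b) (\<gamma> s)) \<le> C * \<bar>s\<bar> ^ n"
      by (rule exI[of _ "A + B"])
  qed
  show "c *s a \<in> arc_vanishing S n x" if a: "a \<in> arc_vanishing S n x" for c a
    unfolding arc_vanishing_def
  proof (intro CollectI allI impI)
    fix w \<gamma> assume arc: "arc_in S x w \<gamma>"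
    obtain A where A: "\<forall>\<^sub>F s in at 0. cmod (linear_form a (\<gamma> s)) \<le> A * \<bar>s\<bar> ^ n"
      using a arc unfolding arc_vanishing_def by blast
    then have "\<forall>\<^sub>F s in at 0. cmod (linear_form (c *s a) (\<gamma> s)) \<le> (cmod c * A) * \<bar>s\<bar> ^ n"
    proof eventually_elim
      case (elim s)
      then show ?case by (simp add: linear_form_bilinear norm_mult mult.assoc mult_left_mono)
    qed
    then show "\<exists>C. \<forall>\<^sub>F s in at 0. cmod (linear_form (c *s a) (\<gamma> s)) \<le> C * \<bar>s\<bar> ^ n"
      by (rule exI[of _ "cmod c * A"])
  qed
qed

text \<open>The right-hand space is the one whose dimension gets bounded from above. The exponent is
  \<open>k + 1\<close> because a \<open>k\<close>-jet is a class modulo that power of the maximal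
  ideal.\<close>

lemma jet_kernel_subset_arc_vanishing:
  assumes "x \<in> S"
  shows "jet_kernel S k x \<subseteq> arc_vanishing S (k + 1) x"
proof
  fix a assume "a \<in> jet_kernel S k x"
  then have "max_power_section S x (k + 1) (linear_form a)" by (simp add: jet_kernel_def)
  from max_power_section_arc_upper[OF this assms] show "a \<in> arc_vanishing S (k + 1) x"
    unfolding arc_vanishing_def by simp
qed

text \<open>Dividing both estimates by |s|^n would bound \<open>c\<close> by a constant times |s|^(m
  - n), which tends to 0.\<close>

lemma arc_lower_not_vanishing:
  assumes arc: "arc_in S x w \<gamma>" and c: "c > 0" and n: "n < m"
    and lower: "\<forall>\<^sub>F s in at 0. c * \<bar>s\<bar> ^ n \<le> cmod (linear_form a (\<gamma> s))"
  shows "a \<notin> arc_vanishing S m x"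
proof
  assume "a \<in> arc_vanishing S m x"
  then obtain C where "\<forall>\<^sub>F s in at 0. cmod (linear_form a (\<gamma> s)) \<le> C * \<bar>s\<bar> ^ m"
    using arc unfolding arc_vanishing_def by blast
  moreover have "\<forall>\<^sub>F s in at (0::real). s \<noteq> 0" by (simp add: eventually_at_filter)
  ultimately have "\<forall>\<^sub>F s in at 0. c \<le> C * \<bar>s\<bar> ^ (m - n)"
    using lower
  proof eventually_elim
    case (elim s)
    have m: "\<bar>s\<bar> ^ m = \<bar>s\<bar> ^ (m - n) * \<bar>s\<bar> ^ n" using n by (simp flip: power_add)
    have "c * \<bar>s\<bar> ^ n \<le> C * \<bar>s\<bar> ^ m" using elim by linarith
    then have "c * \<bar>s\<bar> ^ n \<le> (C * \<bar>s\<bar> ^ (m - n)) * \<bar>s\<bar> ^ n" unfolding m by (simp only: mult.assoc)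
    moreover have "0 < \<bar>s\<bar> ^ n" using elim by simp
    ultimately show ?case by (rule mult_right_le_imp_le)
  qed
  moreover have "((\<lambda>s. C * \<bar>s\<bar> ^ (m - n)) \<longlongrightarrow> C * \<bar>0\<bar> ^ (m - n)) (at (0::real))"
    by (intro tendsto_intros)
  ultimately have "c \<le> C * \<bar>0::real\<bar> ^ (m - n)"
    by (intro tendsto_lowerbound) auto
  then show False using n c by (simp add: power_0_left)
qed

section \<open>Independence of 2k jets at a point of the line\<close>

context line_on_surface
begin

text \<open>This brings sections with different exponents over the smallest one; the surplus power
  of \<open>h\<close> kills the later terms on the line.\<close>

lemma quot_lower:
  assumes x: "x \<in> W - {0}" and "quot j a x g" "t \<le> j"
  shows "quot t a x (\<lambda>q. h q ^ (j - t) * g q)"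
  unfolding quot_def
proof
  show "regular_at S 1 x (\<lambda>q. h q ^ (j - t) * g q)"
    using regular_at_mult[OF regular_at_power[OF local_equation_regular_at[OF equation[OF x]]], of 1 g]
      assms(2) by (simp add: quot_def)
  have "h q ^ j = h q ^ t * h q ^ (j - t)" for q using assms(3) by (simp flip: power_add)
  then show "zariski_near S x (\<lambda>q. linear_form a q = h q ^ t * (h q ^ (j - t) * g q))"
    using assms(2) by (simp add: quot_def mult.assoc)
qed

text \<open>On a transversal arc |h| is at least c |s| and |Q| at least half its value at
  \<open>x\<close>, so the order of \<open>a\<close> there is at most \<open>t\<close>.\<close>

lemma quot_not_vanishing:
  assumes x: "x \<in> W - {0}" and Q: "quot t a x Q" "Q x \<noteq> 0" and t: "t < m"
  shows "a \<notin> arc_vanishing S m x"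
proof -
  have xS: "x \<in> S" using x line_subset by blast
  obtain w \<gamma> where w: "w \<notin> W" "arc_in S x w \<gamma>" using transversal_arc[OF x] by blast
  obtain c where c: "c > 0" "\<forall>\<^sub>F s in at 0. c * \<bar>s\<bar> \<le> cmod (h (\<gamma> s))"
    using equation_lower[OF x equation[OF x] w(2,1)] by blast
  have "regular_at S 1 x Q" using Q by (simp add: quot_def)
  from tendsto_norm[OF regular_at_arc_tendsto[OF this xS w(2)]]
  have "\<forall>\<^sub>F s in at 0. cmod (Q x) / 2 < cmod (Q (\<gamma> s))"
    using Q(2) by (intro order_tendstoD(1)) auto
  moreover have "\<forall>\<^sub>F s in at 0. linear_form a (\<gamma> s) = h (\<gamma> s) ^ t * Q (\<gamma> s)"
    using Q(1) by (intro arc_in_eventually[OF w(2) zariski_near_eventually]) (simp add: quot_def)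
  ultimately have "\<forall>\<^sub>F s in at 0. (c ^ t * (cmod (Q x) / 2)) * \<bar>s\<bar> ^ t \<le> cmod (linear_form a (\<gamma> s))"
    using c(2)
  proof eventually_elim
    case (elim s)
    have "(c * \<bar>s\<bar>) ^ t * (cmod (Q x) / 2) \<le> cmod (h (\<gamma> s)) ^ t * cmod (Q (\<gamma> s))"
      using elim c(1) by (intro mult_mono power_mono) auto
    then show ?case using elim by (simp add: norm_mult norm_power power_mult_distrib mult_ac)
  qed
  from arc_lower_not_vanishing[OF w(2) _ t this] show ?thesis using Q(2) c(1) by simp
qed

text \<open>The arc has to leave the line, to keep |h| above c |s|, and must also avoid the kernel
  of the differential of \<open>Q\<close>. That differential is nonzero on \<open>x1\<close>, so
  adding \<open>x1\<close> to a transversal vector in the kernel cures the second condition without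
  spoiling the first. The order is then at most \<open>Suc t\<close>.\<close>

lemma quot_not_vanishing_derivative:
  assumes x: "x \<in> W - {0}" and Q: "quot t a x Q" "Q x = 0" and t: "Suc t < m"
    and x1: "x1 \<in> W" "((\<lambda>s. Q (x + s *\<^sub>R x1)) has_vector_derivative \<kappa>) (at 0)" "\<kappa> \<noteq> 0"
  shows "a \<notin> arc_vanishing S m x"
proof -
  have xS: "x \<in> S" using x line_subset by blast
  have "regular_at S 1 x Q" using Q by (simp add: quot_def)
  from regular_at_arc_derivative[OF this xS]
  obtain D where D: "\<And>w \<gamma>. arc_in S x w \<gamma> \<Longrightarrow> ((\<lambda>s. Q (\<gamma> s)) has_vector_derivative linear_form D w) (at 0)"
    by blast
  have Dx1: "linear_form D x1 \<noteq> 0"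
    using vector_derivative_unique_at[OF D[OF arc_on_line[OF x x1(1)]] x1(2)] x1(3) by simp
  obtain T where T: "vec.subspace T" "W \<subset> T" "\<forall>w\<in>T. \<exists>\<gamma>. arc_in S x w \<gamma>"
    using tangent_space[OF x] by blast
  obtain w where w: "w \<in> T" "w \<notin> W" "linear_form D w \<noteq> 0"
  proof -
    obtain w where w: "w \<in> T" "w \<notin> W" using T(2) by blast
    show ?thesis
    proof (cases "linear_form D w = 0")
      case True
      have "w + x1 \<in> T" using w x1 T by (intro vec.subspace_add) auto
      moreover have "w + x1 \<notin> W"
        using w(2) vec.subspace_diff[OF subspace _ x1(1), of "w + x1"] by auto
      moreover have "linear_form D (w + x1) \<noteq> 0" using True Dx1 by (simp add: linear_form_bilinear)
      ultimately show ?thesis using that by blast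
    next
      case False
      then show ?thesis using that w by blast
    qed
  qed
  obtain \<gamma> where \<gamma>: "arc_in S x w \<gamma>" using T(3) w(1) by blast
  obtain c where c: "c > 0" "\<forall>\<^sub>F s in at 0. c * \<bar>s\<bar> \<le> cmod (h (\<gamma> s))"
    using equation_lower[OF x equation[OF x] \<gamma> w(2)] by blast
  have "Q (\<gamma> 0) = 0" using \<gamma> Q(2) by (simp add: arc_in_def)
  let ?d = "cmod (linear_form D w) / 2"
  from has_vector_derivative_bounds(2)[OF D[OF \<gamma>] \<open>Q (\<gamma> 0) = 0\<close>, of ?d]
  have "\<forall>\<^sub>F s in at 0. ?d * \<bar>s\<bar> \<le> cmod (Q (\<gamma> s))" using w(3) by simp
  moreover have "\<forall>\<^sub>F s in at 0. linear_form a (\<gamma> s) = h (\<gamma> s) ^ t * Q (\<gamma> s)"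
    using Q(1) by (intro arc_in_eventually[OF \<gamma> zariski_near_eventually]) (simp add: quot_def)
  ultimately have "\<forall>\<^sub>F s in at 0. (c ^ t * ?d) * \<bar>s\<bar> ^ Suc t \<le> cmod (linear_form a (\<gamma> s))"
    using c(2)
  proof eventually_elim
    case (elim s)
    have "(c * \<bar>s\<bar>) ^ t * (?d * \<bar>s\<bar>) \<le> cmod (h (\<gamma> s)) ^ t * cmod (Q (\<gamma> s))"
      using elim c(1) by (intro mult_mono power_mono) auto
    then show ?case using elim by (simp add: norm_mult norm_power power_mult_distrib mult_ac)
  qed
  from arc_lower_not_vanishing[OF \<gamma> _ t this] show ?thesis using w(3) c(1) by simp
qed

text \<open>Take the least index \<open>t\<close> carrying a nonzero coefficient and divide the
  combination by the t-th power of \<open>h\<close>. At \<open>x\<close> the quotient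
  \<open>Q\<close> is a nonzero multiple of \<open>\<alpha> t\<close>; if that coefficient is 0, its
  derivative along the line is \<open>\<beta> t * \<kappa> t\<close>. Either way the order is at
  most \<open>t + 1\<close>, hence at most \<open>k\<close>.\<close>

lemma independent_modulo_vanishing:
  assumes x: "x \<in> W - {0}" and x1: "x1 \<in> W"
    and g: "\<And>j. j < k \<Longrightarrow> quot j (a j) x (g j)" "\<And>j. j < k \<Longrightarrow> g j x \<noteq> 0"
    and g': "\<And>j. j < k \<Longrightarrow> quot j (b j) x (g' j)" "\<And>j. j < k \<Longrightarrow> g' j x = 0"
      "\<And>j. j < k \<Longrightarrow> \<kappa> j \<noteq> 0"
      "\<And>j. j < k \<Longrightarrow> ((\<lambda>s. g' j (x + s *\<^sub>R x1)) has_vector_derivative \<kappa> j) (at 0)"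
    and mem: "(\<Sum>j<k. \<alpha> j *s a j + \<beta> j *s b j) \<in> arc_vanishing S (k + 1) x"
  shows "\<forall>j<k. \<alpha> j = 0 \<and> \<beta> j = 0"
proof (rule ccontr)
  assume "\<not> (\<forall>j<k. \<alpha> j = 0 \<and> \<beta> j = 0)"
  then obtain t where t: "t < k" "\<not> (\<alpha> t = 0 \<and> \<beta> t = 0)" "\<And>j. j < t \<Longrightarrow> \<alpha> j = 0 \<and> \<beta> j = 0"
    using exists_least_iff[of "\<lambda>j. j < k \<and> \<not> (\<alpha> j = 0 \<and> \<beta> j = 0)"] by (metis less_trans)
  let ?F = "\<Sum>j<k. \<alpha> j *s a j + \<beta> j *s b j"
  define Q where "Q q = (\<Sum>j\<in>{t..<k}. 1 * (h q ^ (j - t) * (\<alpha> j * g j q + \<beta> j * g' j q)))" for q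
  have "?F = (\<Sum>j\<in>{t..<k}. 1 *s (\<alpha> j *s a j + \<beta> j *s b j))"
    using t by (intro sum.mono_neutral_cong_right) auto
  moreover have "quot t (\<Sum>j\<in>{t..<k}. 1 *s (\<alpha> j *s a j + \<beta> j *s b j)) x Q"
    unfolding Q_def[abs_def]
    by (intro quot_sum quot_lower[OF x] quot_linear_combination) (auto intro: g g')
  ultimately have quotQ: "quot t ?F x Q" by simp
  \<comment> \<open>On the zero set of \<open>h\<close> only the term j = t survives, where the
    exponent of \<open>h\<close> is 0.\<close>
  have Qval: "Q q = \<alpha> t * g t q + \<beta> t * g' t q" if "h q = 0" for q
  proof -
    have "Q q = (\<alpha> t * g t q + \<beta> t * g' t q) +
        (\<Sum>j\<in>{Suc t..<k}. 1 * (h q ^ (j - t) * (\<alpha> j * g j q + \<beta> j * g' j q)))"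
      using t(1) by (simp add: Q_def sum.atLeast_Suc_lessThan)
    also have "(\<Sum>j\<in>{Suc t..<k}. 1 * (h q ^ (j - t) * (\<alpha> j * g j q + \<beta> j * g' j q))) = 0"
      using that by (intro sum.neutral) auto
    finally show ?thesis by simp
  qed
  have Qx: "Q x = \<alpha> t * g t x" using Qval[OF equation_zero[OF x]] g'(2) t(1) by simp
  show False
  proof (cases "\<alpha> t = 0")
    case False
    then have "Q x \<noteq> 0" using Qx g(2) t(1) by simp
    from quot_not_vanishing[OF x quotQ this, of "k + 1"] t(1) mem show False by simp
  next
    case True
    then have \<beta>: "\<beta> t \<noteq> 0" using t(2) by simp
    let ?\<gamma> = "\<lambda>s. x + s *\<^sub>R x1"
    have arc: "arc_in S x x1 ?\<gamma>" by (rule arc_on_line[OF x x1])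
    have "\<forall>\<^sub>F s in at 0. ?\<gamma> s \<in> S" using arc by (simp add: arc_in_def)
    then have "\<forall>\<^sub>F s in at 0. Q (?\<gamma> s) = \<beta> t * g' t (?\<gamma> s)"
    proof eventually_elim
      case (elim s)
      have "?\<gamma> s \<in> W" using x x1 subspace
        by (simp add: scaleR_vec_conv_vector_scalar_mult vec.subspace_add vec.subspace_scale)
      then have "?\<gamma> s \<in> W - {0}" using elim zero_notin by auto
      from Qval[OF equation_zero[OF this]] show ?case using True by simp
    qed
    moreover have "Q (?\<gamma> 0) = \<beta> t * g' t (?\<gamma> 0)" using Qx True g'(2) t(1) by simp
    moreover have "((\<lambda>s. \<beta> t * g' t (?\<gamma> s)) has_vector_derivative \<beta> t * \<kappa> t) (at 0)"
      using g'(4)[OF t(1)] by (rule has_vector_derivative_mult_right)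
    ultimately have "((\<lambda>s. Q (?\<gamma> s)) has_vector_derivative \<beta> t * \<kappa> t) (at 0)"
      by (rule has_vector_derivative_cong_at)
    from quot_not_vanishing_derivative[OF x quotQ _ _ x1 this, of "k + 1"] \<beta> g'(3) Qx True t(1) mem
    show False by simp
  qed
qed

lemma dim_arc_vanishing:
  assumes x: "x \<in> W - {0}" and bpf: "\<And>t. t < k \<Longrightarrow> base_point_free t"
  shows "2 * k + vec.dim (arc_vanishing S (k + 1) x) \<le> CARD('n)"
proof -
  have "x \<in> W" "x \<noteq> 0" using x by auto
  from two_dimensional_subspace[OF subspace dim this]
  obtain x1 where x1: "x1 \<in> W" "\<And>\<alpha> \<beta>. \<alpha> *s x + \<beta> *s x1 = 0 \<Longrightarrow> \<alpha> = 0 \<and> \<beta> = 0" by blast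
  define R where "R j = (\<lambda>(a, b, g, g', \<kappa>). quot j a x g \<and> g x \<noteq> 0 \<and> quot j b x g' \<and> g' x = 0 \<and>
      \<kappa> \<noteq> 0 \<and> ((\<lambda>s. g' (x + s *\<^sub>R x1)) has_vector_derivative \<kappa>) (at 0))" for j
  have "\<forall>j\<in>{..<k}. \<exists>r. R j r"
  proof
    fix j assume "j \<in> {..<k}"
    then have "base_point_free j" by (intro bpf) simp
    from base_point_free_two_sections[OF this x x1] show "\<exists>r. R j r" by (simp add: R_def)
  qed
  from bchoice[OF this] obtain r where r: "\<forall>j\<in>{..<k}. R j (r j)" by (elim exE)
  define a b g g' \<kappa> where "a j = fst (r j)" and "b j = fst (snd (r j))" and "g j = fst (snd (snd (r j)))"
    and "g' j = fst (snd (snd (snd (r j))))" and "\<kappa> j = snd (snd (snd (snd (r j))))" for j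
  have *: "quot j (a j) x (g j) \<and> g j x \<noteq> 0 \<and> quot j (b j) x (g' j) \<and> g' j x = 0 \<and> \<kappa> j \<noteq> 0 \<and>
      ((\<lambda>s. g' j (x + s *\<^sub>R x1)) has_vector_derivative \<kappa> j) (at 0)" if "j < k" for j
    using r that by (simp add: R_def case_prod_beta a_def b_def g_def g'_def \<kappa>_def)
  \<comment> \<open>Two sections for each exponent: the boolean separates the one nonzero at
    \<open>x\<close> from the one vanishing there.\<close>
  let ?I = "{..<k} \<times> (UNIV :: bool set)"
  define e where "e = (\<lambda>(j, y). if y then a j else b j)"
  have "card ?I + vec.dim (arc_vanishing S (k + 1) x) \<le> CARD('n)"
  proof (rule card_plus_dim_le[OF _ arc_vanishing_subspace])
    fix c assume "(\<Sum>i\<in>?I. c i *s e i) \<in> arc_vanishing S (k + 1) x"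
    moreover have "(\<Sum>i\<in>?I. c i *s e i) = (\<Sum>j<k. \<Sum>y\<in>UNIV. c (j, y) *s e (j, y))"
      by (simp add: sum.cartesian_product case_prod_beta)
    moreover have "\<dots> = (\<Sum>j<k. c (j, True) *s a j + c (j, False) *s b j)"
      by (simp add: UNIV_bool e_def add.commute)
    ultimately have "\<forall>j<k. c (j, True) = 0 \<and> c (j, False) = 0"
      using * by (intro independent_modulo_vanishing[OF x x1(1), where g = g and g' = g' and \<kappa> = \<kappa>]) auto
    then show "\<forall>i\<in>?I. c i = 0" by (auto; metis (full_types))
  qed simp
  then show ?thesis by (simp add: card_cartesian_product)
qed

end

text \<open>Annihilators reverse inclusions: the osculating space is the annihilator of the jet
  kernel, hence contains that of \<open>arc_vanishing\<close>. The latter is cut out by a basis,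
  each member of which costs at most one dimension.\<close>

lemma dim_osculating_space:
  fixes S :: "(complex^'n) set"
  assumes "x \<in> S"
  shows "CARD('n) \<le> vec.dim (osculating_space S k x) + vec.dim (arc_vanishing S (k + 1) x)"
proof -
  let ?K = "arc_vanishing S (k + 1) x"
  obtain B where B: "B \<subseteq> ?K" "vec.independent B" "?K \<subseteq> vec.span B" "card B = vec.dim ?K"
    by (rule vec.basis_exists)
  have "{y. \<forall>a\<in>B. linear_form a y = 0} \<subseteq> osculating_space S k x"
  proof
    fix y assume y: "y \<in> {y. \<forall>a\<in>B. linear_form a y = 0}"
    have "vec.subspace {a. linear_form a y = 0}"
      by (auto intro!: vec.subspaceI simp: linear_form_bilinear)
    then have "vec.span B \<subseteq> {a. linear_form a y = 0}" using y by (intro vec.span_minimal) auto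
    then show "y \<in> osculating_space S k x"
      using B(3) jet_kernel_subset_arc_vanishing[OF assms, of k] unfolding osculating_space_def by blast
  qed
  then have "vec.dim {y. \<forall>a\<in>B. linear_form a y = 0} \<le> vec.dim (osculating_space S k x)"
    by (rule vec.dim_subset)
  moreover have "finite B" using B(2) by (rule vec.finiteI_independent)
  ultimately show ?thesis using dim_annihilator_ge[of B] B(4) by simp
qed

theorem theorem5p2:
  fixes S :: "(complex^'n) set" and C :: "(complex^'m) set"
    and \<pi> :: "complex^'n \<Rightarrow> complex^'m" and x :: "complex^'n" and k N :: nat
  assumes "3 \<le> k"
    and "CARD('n) = N + 1"
    and "surface_scroll S C \<pi>"
    and "nondegenerate S"
    and "2 * k \<le> N"
    and "x \<in> S"
    and "\<And>t. t \<le> k - 2 \<Longrightarrow> very_ample_minus S (fibre S \<pi> (\<pi> x)) t"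
  shows "int k + 2 \<le> proj_dim (osculating_space S k x)"
proof -
  have var: "smooth_projective_variety 2 S" and mor: "morphism S C \<pi>"
    and fib: "\<forall>c\<in>C. (\<exists>W. vec.subspace W \<and> vec.dim W = 2 \<and> fibre S \<pi> c = W - {0}) \<and>
        (\<exists>z. local_parameter C c z \<and>
           (\<forall>p\<in>fibre S \<pi> c. local_equation S (fibre S \<pi> c) p (z \<circ> \<pi>)))"
    using assms(3) unfolding surface_scroll_def by blast+
  have "\<pi> x \<in> C" using mor assms(6) unfolding morphism_def by blast
  with fib obtain W z where W: "vec.subspace W" "vec.dim W = 2" "fibre S \<pi> (\<pi> x) = W - {0}"
    and z: "\<forall>p\<in>fibre S \<pi> (\<pi> x). local_equation S (fibre S \<pi> (\<pi> x)) p (z \<circ> \<pi>)" by blast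
  have "0 \<notin> S"
    using var unfolding smooth_projective_variety_def projective_variety_def projective_closed_def
    by blast
  moreover have "smooth_of_dim 2 S" using var by (simp add: smooth_projective_variety_def)
  moreover have "W - {0} \<subseteq> S" unfolding W(3)[symmetric] fibre_def by blast
  moreover have "local_equation S (W - {0}) p (z \<circ> \<pi>)" if "p \<in> W - {0}" for p
    using z that unfolding W(3) by blast
  \<comment> \<open>The pullback of a local parameter of the base at \<open>\<pi> x\<close> is the
    common equation of the fibre at all its points.\<close>
  ultimately interpret line_on_surface S W "z \<circ> \<pi>"
    using W(1,2) by unfold_locales
  have "proj_eq (\<pi> x) (\<pi> x)" unfolding proj_eq_def by (intro exI[of _ 1]) simp
  then have x: "x \<in> W - {0}" unfolding W(3)[symmetric] fibre_def using assms(6) by simp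
  \<comment> \<open>The exponents up to \<open>k - 2\<close> are covered by very ampleness itself;
    the remaining \<open>k - 1\<close> is the successor of the last of them.\<close>
  have bpf: "base_point_free t" if t: "t < k" for t
  proof (cases "t \<le> k - 2")
    case True
    then show ?thesis using assms(7) W(3) very_ample_base_point_free by simp
  next
    case False
    then have "t = Suc (k - 2)" using t assms(1) by simp
    then show ?thesis using assms(7)[of "k - 2"] W(3) very_ample_base_point_free_Suc by simp
  qed
  from dim_arc_vanishing[OF x bpf, of k] dim_osculating_space[OF assms(6), of k]
  have "2 * k \<le> vec.dim (osculating_space S k x)" by linarith
  \<comment> \<open>The projective dimension is at least 2k - 1, and 2k - 1 >= k + 2 amounts to k >=
    3.\<close>
  then show ?thesis using assms(1) by (simp add: proj_dim_def)
qed

end
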